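(* Let $\beta_1,\dots,\beta_s,\gamma_1,\dots,\gamma_t$ be fixed, and suppose that the graphs $\mathcal{D}_{n}=Cay(\mathbb{D}_{n}, b^{\pm\beta_1},\ldots,b^{\pm\beta_s}, a b^{\gamma_1},\ldots, a b^{\gamma_t})$ are connected for all sufficiently large $n$. Then the number $\tau(n)$ of spanning trees of $\mathcal{D}_{n}$ satisfies $$\tau(n)\sim \frac{n\,t}{q}A^n,\qquad n\to\infty,$$ where $A=\exp\left(\int_{0}^{1}\log P(e^{2\pi \mathrm{i}\theta})\,d\theta\right)$ and $q=2t\sum_{j=1}^{s}\beta_{j}^2+\sum_{1\le j<k\le t}(\gamma_j-\gamma_k)^2$. Here $f(n)\sim g(n)$ means $f(n)/g(n)\to1$.
   Context: Let $\mathbb{D}_n=\langle a,b\mid a^2=1,\ b^n=1,\ (ab)^2=1\rangle$ be the dihedral group of order $2n$. Let $s\ge 0$, $t\ge 1$ be fixed integers and let $0<\beta_1<\cdots<\beta_s$ and $0\le\gamma_1<\cdots<\gamma_t$ be fixed integers; $n$ is always taken large enough that $\beta_s<\frac n2$ (when $s\ge1$) and $\gamma_t\le n-1$. Put $S=\{b^{\pm\beta_1},\ldots,b^{\pm\beta_s},ab^{\gamma_1},\ldots,ab^{\gamma_t}\}$; then $S=S^{-1}$ and $1\notin S$. The Cayley graph $\mathcal{D}_n=Cay(\mathbb{D}_n,b^{\pm\beta_1},\ldots,b^{\pm\beta_s},ab^{\gamma_1},\ldots,ab^{\gamma_t})$ is the simple undirected graph with vertex set $\mathbb{D}_n$ in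 which $g,h$ are adjacent iff $h=gx$ for some $x\in S$. The associated Laurent polynomial of $\mathcal{D}_n$ is $P(z)=\mathcal{A}(z)\mathcal{A}(z^{-1})-\mathcal{B}(z)\mathcal{B}(z^{-1})$, where $\mathcal{A}(z)=2s+t-\sum_{i=1}^{s}(z^{\beta_i}+z^{-\beta_i})$ and $\mathcal{B}(z)=-\sum_{i=1}^{t}z^{\gamma_i}$; it does not depend on $n$. *)

theory Defs
  imports "HOL-Analysis.Analysis" "HOL-Algebra.Generated_Groups"
begin

section \<open>Simple undirected graphs\<close>

text \<open>
  A graph is given by a vertex set \<open>V\<close> and a set \<open>E\<close> of unordered pairs \<open>{u, v}\<close>.
\<close>

definition graph_connected :: "'a set \<Rightarrow> 'a set set \<Rightarrow> bool" where
  "graph_connected V E \<longleftrightarrow> V \<noteq> {} \<and>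
     (\<forall>u\<in>V. \<forall>v\<in>V. (u, v) \<in> {(x, y). x \<in> V \<and> y \<in> V \<and> {x, y} \<in> E}\<^sup>*)"

definition is_cycle :: "'a set set \<Rightarrow> 'a list \<Rightarrow> bool" where
  "is_cycle E p \<longleftrightarrow> length p \<ge> 3 \<and> distinct p \<and>
     (\<forall>i. Suc i < length p \<longrightarrow> {p ! i, p ! Suc i} \<in> E) \<and> {last p, hd p} \<in> E"

definition is_tree :: "'a set \<Rightarrow> 'a set set \<Rightarrow> bool" where
  "is_tree V E \<longleftrightarrow> graph_connected V E \<and> \<not> (\<exists>p. is_cycle E p)"

text \<open>A spanning tree contains every vertex, so it is determined by its edge set.\<close>

definition spanning_trees :: "'a set \<Rightarrow> 'a set set \<Rightarrow> 'a set set set" where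
  "spanning_trees V E = {T. T \<subseteq> E \<and> is_tree V T}"


section \<open>Cayley graphs\<close>

text \<open>The vertex set is \<open>carrier G\<close>.\<close>

definition cayley_edges :: "('a, 'm) monoid_scheme \<Rightarrow> 'a set \<Rightarrow> 'a set set" where
  "cayley_edges G S =
     {{g, h} | g h. g \<in> carrier G \<and> h \<in> carrier G \<and> (\<exists>x\<in>S. h = g \<otimes>\<^bsub>G\<^esub> x)}"


section \<open>The dihedral group\<close>

text \<open>
  For \<open>n \<ge> 1\<close>, the pair \<open>(e, k)\<close> stands for the normal form \<open>b\<^sup>k\<close> (if \<open>\<not> e\<close>) or
  \<open>a b\<^sup>k\<close> (if \<open>e\<close>) with \<open>0 \<le> k < n\<close>; the product comes from \<open>b\<^sup>k a = a b\<^sup>-\<^sup>k\<close>.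
  The lemmas below show that this is the group of order \<open>2 n\<close> presented by
  \<open>a\<^sup>2 = b\<^sup>n = (a b)\<^sup>2 = 1\<close>.
\<close>

definition dihedral :: "nat \<Rightarrow> (bool \<times> int) monoid" where
  "dihedral n =
     \<lparr> carrier = UNIV \<times> {0..<int n},
       mult = (\<lambda>(e, k) (f, l). (e \<noteq> f, (if f then l - k else k + l) mod int n)),
       one = (False, 0) \<rparr>"

definition dih_a :: "bool \<times> int" where
  "dih_a = (True, 0)"

definition dih_b :: "nat \<Rightarrow> bool \<times> int" where
  "dih_b n = (False, 1 mod int n)"

lemma dihedral_group:
  assumes "n > 0"
  shows "group (dihedral n)"
proof (rule groupI)
  show "\<one>\<^bsub>dihedral n\<^esub> \<in> carrier (dihedral n)"
    using assms by (simp add: dihedral_def)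
next
  fix x y assume "x \<in> carrier (dihedral n)" "y \<in> carrier (dihedral n)"
  then show "x \<otimes>\<^bsub>dihedral n\<^esub> y \<in> carrier (dihedral n)"
    using assms by (auto simp: dihedral_def split: prod.splits)
next
  fix x y z
  show "x \<otimes>\<^bsub>dihedral n\<^esub> y \<otimes>\<^bsub>dihedral n\<^esub> z = x \<otimes>\<^bsub>dihedral n\<^esub> (y \<otimes>\<^bsub>dihedral n\<^esub> z)"
    by (auto simp: dihedral_def mod_simps algebra_simps split: prod.splits)
next
  fix x assume "x \<in> carrier (dihedral n)"
  then show "\<one>\<^bsub>dihedral n\<^esub> \<otimes>\<^bsub>dihedral n\<^esub> x = x"
    by (auto simp: dihedral_def split: prod.splits)
next
  fix x assume x: "x \<in> carrier (dihedral n)"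
  obtain e k where ek: "x = (e, k)" by (cases x)
  show "\<exists>y\<in>carrier (dihedral n). y \<otimes>\<^bsub>dihedral n\<^esub> x = \<one>\<^bsub>dihedral n\<^esub>"
    by (rule bexI[of _ "(e, (if e then k else - k) mod int n)"])
       (use x assms ek in \<open>auto simp: dihedral_def mod_simps\<close>)
qed

lemma card_dihedral: "card (carrier (dihedral n)) = 2 * n"
  by (simp add: dihedral_def card_cartesian_product)

lemma dih_in_carrier:
  assumes "n > 0"
  shows "dih_a \<in> carrier (dihedral n)" "dih_b n \<in> carrier (dihedral n)"
  using assms by (auto simp: dihedral_def dih_a_def dih_b_def)

lemma dih_b_nat_pow: "dih_b n [^]\<^bsub>dihedral n\<^esub> (k::nat) = (False, int k mod int n)"
proof (induction k)
  case 0
  show ?case by (simp add: dihedral_def)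
next
  case (Suc k)
  have "dih_b n [^]\<^bsub>dihedral n\<^esub> Suc k =
        (False, int k mod int n) \<otimes>\<^bsub>dihedral n\<^esub> dih_b n"
    using Suc by (simp add: nat_pow_def)
  then show ?case
    by (simp add: dihedral_def dih_b_def mod_simps algebra_simps)
qed

lemma dih_b_int_pow:
  assumes "n > 0"
  shows "dih_b n [^]\<^bsub>dihedral n\<^esub> (i::int) = (False, i mod int n)"
proof -
  interpret group "dihedral n" using assms by (rule dihedral_group)
  have inv: "inv\<^bsub>dihedral n\<^esub> (False, k mod int n) = (False, (- k) mod int n)" for k
    by (rule inv_equality) (use assms in \<open>auto simp: dihedral_def mod_simps\<close>)
  show ?thesis
    by (cases "i < 0") (simp_all add: int_pow_def2 dih_b_nat_pow inv)
qed

lemma dih_relations: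
  assumes "n > 0"
  shows "dih_a [^]\<^bsub>dihedral n\<^esub> (2::nat) = \<one>\<^bsub>dihedral n\<^esub>"
    and "dih_b n [^]\<^bsub>dihedral n\<^esub> n = \<one>\<^bsub>dihedral n\<^esub>"
    and "(dih_a \<otimes>\<^bsub>dihedral n\<^esub> dih_b n) [^]\<^bsub>dihedral n\<^esub> (2::nat) = \<one>\<^bsub>dihedral n\<^esub>"
proof -
  interpret group "dihedral n" using assms by (rule dihedral_group)
  show "dih_a [^]\<^bsub>dihedral n\<^esub> (2::nat) = \<one>\<^bsub>dihedral n\<^esub>"
    by (simp add: numeral_2_eq_2 nat_pow_def) (simp add: dihedral_def dih_a_def)
  show "dih_b n [^]\<^bsub>dihedral n\<^esub> n = \<one>\<^bsub>dihedral n\<^esub>"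
    unfolding dih_b_nat_pow by (simp add: dihedral_def)
  show "(dih_a \<otimes>\<^bsub>dihedral n\<^esub> dih_b n) [^]\<^bsub>dihedral n\<^esub> (2::nat) = \<one>\<^bsub>dihedral n\<^esub>"
    by (simp add: numeral_2_eq_2 nat_pow_def) (simp add: dihedral_def dih_a_def dih_b_def)
qed

lemma dih_generate:
  assumes "n > 0"
  shows "generate (dihedral n) {dih_a, dih_b n} = carrier (dihedral n)"
proof
  interpret group "dihedral n" using assms by (rule dihedral_group)
  let ?H = "generate (dihedral n) {dih_a, dih_b n}"
  have sub: "{dih_a, dih_b n} \<subseteq> carrier (dihedral n)"
    using dih_in_carrier[OF assms] by simp
  show "?H \<subseteq> carrier (dihedral n)"
    by (rule generate_incl[OF sub])
  interpret H: subgroup ?H "dihedral n"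
    by (rule generate_is_subgroup[OF sub])
  have a: "dih_a \<in> ?H" and b: "dih_b n \<in> ?H"
    by (auto intro: generate.incl)
  have bk: "dih_b n [^]\<^bsub>dihedral n\<^esub> (k::nat) \<in> ?H" for k
    using b by (induction k) (auto simp: nat_pow_def)
  show "carrier (dihedral n) \<subseteq> ?H"
  proof
    fix x assume x: "x \<in> carrier (dihedral n)"
    obtain e k where ek: "x = (e, k)" by (cases x)
    have k: "0 \<le> k" "k < int n" using x ek by (auto simp: dihedral_def)
    have 1: "(False, k) \<in> ?H"
      using bk[of "nat k"] k by (simp add: dih_b_nat_pow)
    have "dih_a \<otimes>\<^bsub>dihedral n\<^esub> (False, k) \<in> ?H"
      by (rule H.m_closed[OF a 1])
    moreover have "dih_a \<otimes>\<^bsub>dihedral n\<^esub> (False, k) = (True, k)"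
      using k by (simp add: dihedral_def dih_a_def)
    ultimately show "x \<in> ?H" using 1 ek by (cases e) auto
  qed
qed

lemma dih_universal:
  fixes H (structure)
  assumes n: "n > 0" and H: "group H" and xy: "x \<in> carrier H" "y \<in> carrier H"
    and rel: "x [^] (2::nat) = \<one>" "y [^] n = \<one>" "(x \<otimes> y) [^] (2::nat) = \<one>"
  shows "\<exists>\<phi>\<in>hom (dihedral n) H. \<phi> dih_a = x \<and> \<phi> (dih_b n) = y"
proof -
  interpret H: group H by (rule H)
  define \<phi> where "\<phi> = (\<lambda>(e, k). (if e then x else \<one>) \<otimes> y [^] (k::int))"
  have xx: "x \<otimes> x = \<one>"
    using rel(1) xy by (simp add: numeral_2_eq_2)
  have per: "y [^] (k mod int n) = y [^] k" for k
  proof -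
    have "y [^] k = y [^] (int n * (k div int n) + k mod int n)" by simp
    also have "\<dots> = y [^] (int n * (k div int n)) \<otimes> y [^] (k mod int n)"
      using xy by (intro H.int_pow_mult) auto
    also have "y [^] (int n * (k div int n)) = (y [^] int n) [^] (k div int n)"
      using xy by (simp add: H.int_pow_pow)
    also have "y [^] int n = \<one>" using rel(2) by (simp add: int_pow_int)
    finally show ?thesis using xy by simp
  qed
  have xyxy: "x \<otimes> y \<otimes> (x \<otimes> y) = \<one>"
    using rel(3) xy by (simp add: numeral_2_eq_2)
  have invx: "inv x = x" using xx xy by (simp add: H.inv_equality)
  have conj1: "x \<otimes> y \<otimes> x = inv y"
    using xyxy xy by (metis H.inv_equality H.m_assoc H.m_closed)
  have nat_conj: "x \<otimes> y [^] (m::nat) \<otimes> x = inv (y [^] m)" for m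
  proof (induction m)
    case 0
    show ?case using xx xy by simp
  next
    case (Suc m)
    have "x \<otimes> y [^] Suc m \<otimes> x = (x \<otimes> y [^] m \<otimes> x) \<otimes> (x \<otimes> y \<otimes> x)"
    proof -
      have "(x \<otimes> y [^] m \<otimes> x) \<otimes> (x \<otimes> y \<otimes> x) = x \<otimes> y [^] m \<otimes> (x \<otimes> x) \<otimes> y \<otimes> x"
        using xy by (simp add: H.m_assoc)
      then show ?thesis using xx xy by (simp add: H.m_assoc)
    qed
    also have "\<dots> = inv (y [^] m) \<otimes> inv y" using Suc conj1 by simp
    also have "\<dots> = inv (y [^] Suc m)"
      using xy by (metis H.inv_mult_group H.nat_pow_Suc2 H.nat_pow_closed)
    finally show ?case .
  qed
  have swap_nat: "y [^] (int m) \<otimes> x = x \<otimes> y [^] (- int m)" for m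
  proof -
    have "x \<otimes> (x \<otimes> y [^] m \<otimes> x) = x \<otimes> inv (y [^] m)" using nat_conj by simp
    moreover have "x \<otimes> (x \<otimes> y [^] m \<otimes> x) = (x \<otimes> x) \<otimes> y [^] m \<otimes> x"
      using xy by (simp add: H.m_assoc)
    ultimately show ?thesis
      using xx xy by (simp add: H.int_pow_neg int_pow_int)
  qed
  have swap: "y [^] (k::int) \<otimes> x = x \<otimes> y [^] (- k)" for k
  proof (cases "k \<ge> 0")
    case True
    then show ?thesis using swap_nat[of "nat k"] by simp
  next
    case False
    define m where "m = nat (- k)"
    have k: "k = - int m" using False by (simp add: m_def)
    have "x \<otimes> (y [^] int m \<otimes> x) \<otimes> x = x \<otimes> (x \<otimes> y [^] (- int m)) \<otimes> x"
      using swap_nat by simp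
    moreover have "x \<otimes> (y [^] int m \<otimes> x) \<otimes> x = x \<otimes> y [^] int m \<otimes> (x \<otimes> x)"
      using xy by (simp add: H.m_assoc)
    moreover have "x \<otimes> (x \<otimes> y [^] (- int m)) \<otimes> x = (x \<otimes> x) \<otimes> y [^] (- int m) \<otimes> x"
      using xy by (simp add: H.m_assoc)
    ultimately show ?thesis using xx xy k by simp
  qed
  have "\<phi> \<in> hom (dihedral n) H"
  proof (rule homI)
    fix p assume "p \<in> carrier (dihedral n)"
    then show "\<phi> p \<in> carrier H" using xy by (auto simp: \<phi>_def split: prod.splits)
  next
    fix p r :: "bool \<times> int"
    obtain e k f l where pr: "p = (e, k)" "r = (f, l)" by (metis surj_pair)
    show "\<phi> (p \<otimes>\<^bsub>dihedral n\<^esub> r) = \<phi> p \<otimes> \<phi> r"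
    proof (cases f)
      case False
      then show ?thesis using xy
        by (simp add: pr \<phi>_def dihedral_def per H.int_pow_mult H.m_assoc)
    next
      case True
      have "\<phi> p \<otimes> \<phi> r = (if e then x else \<one>) \<otimes> ((y [^] k \<otimes> x) \<otimes> y [^] l)"
        using xy True by (simp add: pr \<phi>_def H.m_assoc)
      also have "\<dots> = (if e then x else \<one>) \<otimes> x \<otimes> (y [^] (- k) \<otimes> y [^] l)"
        using xy by (simp add: swap H.m_assoc)
      also have "y [^] (- k) \<otimes> y [^] l = y [^] (l - k)"
        using xy by (simp add: H.int_pow_mult[symmetric])
      finally show ?thesis using xx xy True
        by (simp add: pr \<phi>_def dihedral_def per)
    qed
  qed
  moreover have "\<phi> dih_a = x" using xy by (simp add: \<phi>_def dih_a_def)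
  moreover have "\<phi> (dih_b n) = y" using xy by (simp add: \<phi>_def dih_b_def per H.int_pow_1)
  ultimately show ?thesis by blast
qed


section \<open>Cayley graphs of dihedral groups\<close>

definition dih_conn_set :: "nat \<Rightarrow> nat \<Rightarrow> (nat \<Rightarrow> nat) \<Rightarrow> (nat \<Rightarrow> nat) \<Rightarrow> nat \<Rightarrow> (bool \<times> int) set" where
  "dih_conn_set s t \<beta> \<gamma> n =
     (\<Union>i\<in>{1..s}. {dih_b n [^]\<^bsub>dihedral n\<^esub> int (\<beta> i), dih_b n [^]\<^bsub>dihedral n\<^esub> (- int (\<beta> i))}) \<union>
     (\<lambda>i. dih_a \<otimes>\<^bsub>dihedral n\<^esub> dih_b n [^]\<^bsub>dihedral n\<^esub> int (\<gamma> i)) ` {1..t}"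

definition dih_graph_edges :: "nat \<Rightarrow> nat \<Rightarrow> (nat \<Rightarrow> nat) \<Rightarrow> (nat \<Rightarrow> nat) \<Rightarrow> nat \<Rightarrow> (bool \<times> int) set set" where
  "dih_graph_edges s t \<beta> \<gamma> n = cayley_edges (dihedral n) (dih_conn_set s t \<beta> \<gamma> n)"

text \<open>For large \<open>n\<close> the connection set is closed under inverses and omits the identity,
  so every edge has two distinct ends and adjacency can be read off from either end.\<close>

lemma dih_graph_edges_iff:
  assumes n: "n > 0" and \<beta>: "\<And>i. i \<in> {1..s} \<Longrightarrow> 0 < \<beta> i \<and> 2 * \<beta> i < n"
  shows "{g, h} \<in> dih_graph_edges s t \<beta> \<gamma> n \<longleftrightarrow>
           g \<in> carrier (dihedral n) \<and> h \<in> carrier (dihedral n) \<and>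
           (\<exists>x\<in>dih_conn_set s t \<beta> \<gamma> n. h = g \<otimes>\<^bsub>dihedral n\<^esub> x)" (is "_ \<longleftrightarrow> ?adj g h")
    and "{g, h} \<in> dih_graph_edges s t \<beta> \<gamma> n \<Longrightarrow> g \<noteq> h"
proof -
  interpret group "dihedral n" using n by (rule dihedral_group)
  let ?S = "dih_conn_set s t \<beta> \<gamma> n"
  have S: "?S = (\<Union>i\<in>{1..s}. {(False, int (\<beta> i) mod int n), (False, (- int (\<beta> i)) mod int n)}) \<union>
                (\<lambda>i. (True, int (\<gamma> i) mod int n)) ` {1..t}"
    unfolding dih_conn_set_def using n
    by (simp add: dih_b_int_pow del: One_nat_def) (simp add: dihedral_def dih_a_def del: One_nat_def)
  have S_carrier: "?S \<subseteq> carrier (dihedral n)"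
    unfolding S using n by (auto simp: dihedral_def)
  have S_inv: "inv\<^bsub>dihedral n\<^esub> x \<in> ?S" if x: "x \<in> ?S" for x
  proof -
    have inv_F: "inv\<^bsub>dihedral n\<^esub> (False, k mod int n) = (False, (- k) mod int n)" for k
      by (rule inv_equality) (use n in \<open>auto simp: dihedral_def mod_simps\<close>)
    have inv_T: "inv\<^bsub>dihedral n\<^esub> (True, k mod int n) = (True, k mod int n)" for k
      by (rule inv_equality) (use n in \<open>auto simp: dihedral_def mod_simps\<close>)
    show ?thesis using x unfolding S by (auto simp: inv_F inv_T)
  qed
  have S_one: "\<one>\<^bsub>dihedral n\<^esub> \<notin> ?S"
  proof
    assume "\<one>\<^bsub>dihedral n\<^esub> \<in> ?S"
    then obtain i where i: "i \<in> {1..s}"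
      and "int (\<beta> i) mod int n = 0 \<or> (- int (\<beta> i)) mod int n = 0"
      unfolding S by (auto simp: dihedral_def)
    then have "int n dvd int (\<beta> i)" by (auto simp: mod_eq_0_iff_dvd)
    then have "n dvd \<beta> i" by simp
    then show False using \<beta>[OF i] by (auto dest: dvd_imp_le)
  qed
  have sym: "?adj h g" if adj: "?adj g h" for g h
  proof -
    obtain x where x: "x \<in> ?S" "h = g \<otimes>\<^bsub>dihedral n\<^esub> x" using adj by blast
    have "x \<in> carrier (dihedral n)" using x S_carrier by blast
    then have "g = h \<otimes>\<^bsub>dihedral n\<^esub> inv\<^bsub>dihedral n\<^esub> x" using adj x by (simp add: m_assoc)
    then show ?thesis using adj S_inv[OF x(1)] by blast
  qed
  show iff: "{g, h} \<in> dih_graph_edges s t \<beta> \<gamma> n \<longleftrightarrow> ?adj g h"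
  proof
    assume "{g, h} \<in> dih_graph_edges s t \<beta> \<gamma> n"
    then obtain g' h' where gh: "{g, h} = {g', h'}" and "?adj g' h'"
      unfolding dih_graph_edges_def cayley_edges_def by blast
    then show "?adj g h" using sym[of g' h'] by (auto simp only: doubleton_eq_iff)
  next
    assume "?adj g h"
    then show "{g, h} \<in> dih_graph_edges s t \<beta> \<gamma> n"
      unfolding dih_graph_edges_def cayley_edges_def by blast
  qed
  show "g \<noteq> h" if e: "{g, h} \<in> dih_graph_edges s t \<beta> \<gamma> n"
  proof
    assume "g = h"
    then obtain x where x: "g \<in> carrier (dihedral n)" "x \<in> ?S" "g = g \<otimes>\<^bsub>dihedral n\<^esub> x"
      using e iff by blast
    have "x \<in> carrier (dihedral n)" using x S_carrier by blast
    then have "x = \<one>\<^bsub>dihedral n\<^esub>" using x by (metis l_cancel_one')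
    then show False using x S_one by simp
  qed
qed

definition dih_graph_connected :: "nat \<Rightarrow> nat \<Rightarrow> (nat \<Rightarrow> nat) \<Rightarrow> (nat \<Rightarrow> nat) \<Rightarrow> nat \<Rightarrow> bool" where
  "dih_graph_connected s t \<beta> \<gamma> n \<longleftrightarrow>
     graph_connected (carrier (dihedral n)) (dih_graph_edges s t \<beta> \<gamma> n)"

definition dih_tau :: "nat \<Rightarrow> nat \<Rightarrow> (nat \<Rightarrow> nat) \<Rightarrow> (nat \<Rightarrow> nat) \<Rightarrow> nat \<Rightarrow> nat" where
  "dih_tau s t \<beta> \<gamma> n =
     card (spanning_trees (carrier (dihedral n)) (dih_graph_edges s t \<beta> \<gamma> n))"


section \<open>The associated Laurent polynomial\<close>

definition laurent_A :: "nat \<Rightarrow> nat \<Rightarrow> (nat \<Rightarrow> nat) \<Rightarrow> complex \<Rightarrow> complex" where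
  "laurent_A s t \<beta> z =
     2 * of_nat s + of_nat t - (\<Sum>i=1..s. z powi int (\<beta> i) + z powi (- int (\<beta> i)))"

definition laurent_B :: "nat \<Rightarrow> (nat \<Rightarrow> nat) \<Rightarrow> complex \<Rightarrow> complex" where
  "laurent_B t \<gamma> z = - (\<Sum>i=1..t. z ^ \<gamma> i)"

definition laurent_P :: "nat \<Rightarrow> nat \<Rightarrow> (nat \<Rightarrow> nat) \<Rightarrow> (nat \<Rightarrow> nat) \<Rightarrow> complex \<Rightarrow> complex" where
  "laurent_P s t \<beta> \<gamma> z =
     laurent_A s t \<beta> z * laurent_A s t \<beta> (inverse z) - laurent_B t \<gamma> z * laurent_B t \<gamma> (inverse z)"

text \<open>On the unit circle \<open>P\<close> takes nonnegative real values, so the logarithm in the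
  Mahler measure below may be taken of the real part.\<close>

lemma laurent_P_unit_circle:
  assumes "norm z = 1"
  shows "Im (laurent_P s t \<beta> \<gamma> z) = 0" "Re (laurent_P s t \<beta> \<gamma> z) \<ge> 0"
proof -
  have inv: "inverse z = cnj z"
    using assms complex_norm_square[of z] by (simp add: inverse_unique)
  have z0: "z \<noteq> 0" using assms by auto
  have np: "norm (z powi k) = 1" for k
    using assms by (simp add: norm_power_int)
  have pm: "z powi int k + z powi (- int k) = of_real (2 * Re (z powi int k))" for k
  proof -
    have "z powi (- int k) = cnj (z powi int k)"
      by (simp add: power_int_minus inv[symmetric] power_inverse)
    then show ?thesis by (simp only: complex_add_cnj)
  qed
  define r where "r = 2 * real s + real t - (\<Sum>i=1..s. 2 * Re (z powi int (\<beta> i)))"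
  have A: "laurent_A s t \<beta> z = of_real r"
    unfolding laurent_A_def r_def pm by simp
  have A': "laurent_A s t \<beta> (inverse z) = of_real r"
    unfolding A[symmetric] laurent_A_def
    by (simp add: power_int_minus power_inverse add.commute)
  have B': "laurent_B t \<gamma> (inverse z) = cnj (laurent_B t \<gamma> z)"
    by (simp add: laurent_B_def inv)
  have P: "laurent_P s t \<beta> \<gamma> z = of_real (r\<^sup>2 - (norm (laurent_B t \<gamma> z))\<^sup>2)"
    unfolding laurent_P_def A A' B' complex_norm_square[symmetric]
    by (simp add: power2_eq_square complex_norm_square)
  show "Im (laurent_P s t \<beta> \<gamma> z) = 0" unfolding P by simp
  have "(\<Sum>i=1..s. 2 * Re (z powi int (\<beta> i))) \<le> (\<Sum>i=1..s. 2)"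
  proof (rule sum_mono)
    fix i show "2 * Re (z powi int (\<beta> i)) \<le> 2"
      using complex_Re_le_cmod[of "z powi int (\<beta> i)"] np[of "int (\<beta> i)"] by linarith
  qed
  then have r: "r \<ge> real t" by (simp add: r_def)
  have "norm (laurent_B t \<gamma> z) \<le> (\<Sum>i=1..t. norm (z ^ \<gamma> i))"
    unfolding laurent_B_def norm_minus_cancel by (rule norm_sum)
  also have "\<dots> = real t" using assms by (simp add: norm_power)
  finally have "(norm (laurent_B t \<gamma> z))\<^sup>2 \<le> r\<^sup>2"
    using r by (intro power_mono) auto
  then show "Re (laurent_P s t \<beta> \<gamma> z) \<ge> 0" unfolding P by simp
qed

definition mahler_P :: "nat \<Rightarrow> nat \<Rightarrow> (nat \<Rightarrow> nat) \<Rightarrow> (nat \<Rightarrow> nat) \<Rightarrow> real" where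
  "mahler_P s t \<beta> \<gamma> =
     exp (integral {0..1} (\<lambda>\<theta>. ln (Re (laurent_P s t \<beta> \<gamma> (exp (2 * of_real pi * \<i> * of_real \<theta>))))))"

definition dih_q :: "nat \<Rightarrow> nat \<Rightarrow> (nat \<Rightarrow> nat) \<Rightarrow> (nat \<Rightarrow> nat) \<Rightarrow> real" where
  "dih_q s t \<beta> \<gamma> =
     2 * real t * (\<Sum>j=1..s. (real (\<beta> j))\<^sup>2) +
     (\<Sum>k=1..t. \<Sum>j=1..<k. (real (\<gamma> j) - real (\<gamma> k))\<^sup>2)"

end

theory Submission
  imports Defs "Jordan_Normal_Form.Determinant"
    "HOL-Computational_Algebra.Fundamental_Theorem_Algebra"
begin

text \<open>
  The number of spanning trees is computed exactly and then compared with an integral.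

  Exact formula. Expanding \<open>det (x I + L)\<close>, where \<open>L\<close> is the graph Laplacian on \<open>N\<close> vertices,
  by multilinearity in the rows gives a sum over rooted spanning forests in which each root
  contributes a factor \<open>x\<close>; the linear coefficient counts pairs of a spanning tree and a root, so
  \<open>det (x I + L) / x\<close> tends to \<open>N \<tau>\<close> as \<open>x \<rightarrow> 0\<close> (\<open>matrix_tree_limit\<close>). For the dihedral graph
  \<open>N = 2 n\<close>, and after listing the reflections in reversed order the Laplacian has four circulant
  blocks. The discrete Fourier transform diagonalises all of them at once, leaving a \<open>2 \<times> 2\<close>
  determinant for each \<open>n\<close>-th root of unity \<open>z\<close>, namely \<open>(x + A(z))\<^sup>2 - B(z) B(1/z)\<close>. At \<open>z = 1\<close>
  this is \<open>x (x + 2 t)\<close>; letting \<open>x \<rightarrow> 0\<close> yields \<open>n \<tau>(n) = t \<Prod> P(z)\<close> over the \<open>n\<close>-th roots of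
  unity \<open>z \<noteq> 1\<close> (\<open>dih_tau_product\<close>).

  Asymptotics. On the unit circle \<open>P(z) = \<bar>1 - z\<bar>\<^sup>2 Q(z)\<close> where \<open>Q\<close> is an explicit sum of
  nonnegative terms (\<open>laurent_P_factor\<close>), and \<open>Q(1) = q\<close>. The factors \<open>\<bar>1 - z\<bar>\<^sup>2\<close> multiply to \<open>n\<^sup>2\<close>, so
  \<open>q \<tau>(n) = n t \<Prod> Q(z)\<close>, now over all \<open>n\<close>-th roots of unity. Connectedness for all large \<open>n\<close>
  forces \<open>Q > 0\<close> on the whole circle (\<open>circle_Q_pos\<close>): apart from the perfect matchings with
  \<open>s = 0\<close> and \<open>t = 1\<close>, a zero would be a root of unity \<open>z \<noteq> 1\<close> and would define, for all multiples \<open>n\<close>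
  of its order, a nonconstant function on the vertices that is constant along edges. Hence \<open>ln Q\<close> is a
  smooth periodic function, and its Riemann sum \<open>\<Sum> ln Q(exp (2 \<pi> \<i> k / n))\<close> differs from
  \<open>n \<integral> ln Q\<close> by \<open>O(1/n)\<close>, because for periodic functions it is the trapezoidal rule
  (\<open>periodic_riemann_sum\<close>). Since \<open>\<integral> ln \<bar>1 - z\<bar>\<^sup>2 = 0\<close> (\<open>integral_ln_sin\<close>), the integrals of
  \<open>ln P\<close> and \<open>ln Q\<close> agree, and the product of the \<open>Q(z)\<close> is asymptotic to \<open>A\<^sup>n\<close>.
\<close>

hide_const (open) Determinants.det Finite_Cartesian_Product.mat Finite_Cartesian_Product.vec
no_notation Finite_Cartesian_Product.vec_nth (infixl \<open>$\<close> 90)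

section \<open>Determinants as sums over rooted forests\<close>

text \<open>
  Rooted forests on the vertices \<open>0, \<dots>, N - 1\<close> are encoded by parent maps: \<open>f i\<close> is the parent
  of \<open>i\<close>, and the extra value \<open>N\<close> serves as a virtual vertex above all roots. The map is a forest
  exactly if every vertex climbs to \<open>N\<close>.
\<close>
definition reaches_root :: "nat \<Rightarrow> (nat \<Rightarrow> nat) \<Rightarrow> bool" where
  "reaches_root N f \<longleftrightarrow> (\<forall>i<N. \<exists>k. (f ^^ k) i = N)"

text \<open>
  The Laplacian of the parent map, with the row and column of the virtual vertex \<open>N\<close> removed.
\<close>
definition parent_mat :: "nat \<Rightarrow> (nat \<Rightarrow> nat) \<Rightarrow> 'a :: comm_ring_1 mat" where
  "parent_mat N f = mat N N (\<lambda>(i, j). of_bool (i = j) - of_bool (f i = j))"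

text \<open>
  Only the identity contributes to the Leibniz formula: if a permutation moves \<open>i\<close> and has nonzero
  product, it must send \<open>i\<close> to its parent, which it then moves as well. So the whole path from \<open>i\<close>
  upwards is permuted inside \<open>{0..<N}\<close> and never reaches \<open>N\<close>.
\<close>
lemma det_parent_mat_reaching:
  assumes "reaches_root N f"
  shows "det (parent_mat N f :: 'a :: comm_ring_1 mat) = 1"
proof -
  let ?S = "{p. p permutes {0..<N}}"
  let ?g = "\<lambda>p. signof p * (\<Prod>i=0..<N. (parent_mat N f :: 'a mat) $$ (i, p i))"
  have zero: "?g p = 0" if p: "p permutes {0..<N}" "p \<noteq> id" for p
  proof (rule ccontr)
    assume "?g p \<noteq> 0"
    then have nz: "(\<Prod>i=0..<N. (parent_mat N f :: 'a mat) $$ (i, p i)) \<noteq> 0" by auto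
    have step: "p i = i \<or> p i = f i" if "i < N" for i
    proof (rule ccontr)
      assume "\<not> (p i = i \<or> p i = f i)"
      moreover have "p i < N" using p(1) that by (simp add: permutes_nat_less)
      ultimately have "(parent_mat N f :: 'a mat) $$ (i, p i) = 0"
        using that by (simp add: parent_mat_def)
      then have "(\<Prod>i=0..<N. (parent_mat N f :: 'a mat) $$ (i, p i)) = 0"
        using that by (intro prod_zero) auto
      then show False using nz by simp
    qed
    obtain i where i: "p i \<noteq> i" using p(2) by (auto simp: fun_eq_iff)
    then have iN: "i < N" using p(1) by (metis atLeastLessThan_iff permutes_not_in zero_le)
    \<comment> \<open>The moved points climb along \<open>f\<close> without ever leaving \<open>{0..<N}\<close>.\<close>
    have "(f ^^ k) i < N \<and> p ((f ^^ k) i) \<noteq> (f ^^ k) i" for k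
    proof (induction k)
      case 0
      show ?case using i iN by simp
    next
      case (Suc k)
      let ?j = "(f ^^ k) i"
      have pj: "p ?j = f ?j" using step[of ?j] Suc by auto
      have "p ?j < N" using p(1) Suc by (simp add: permutes_nat_less)
      moreover have "p (p ?j) \<noteq> p ?j"
        using Suc permutes_inj[OF p(1)] by (auto dest: injD)
      ultimately show ?case using pj by simp
    qed
    then show False using assms iN unfolding reaches_root_def by (metis less_irrefl)
  qed
  have no_fix: "f i \<noteq> i" if "i < N" for i
  proof
    assume "f i = i"
    then have "(f ^^ k) i = i" for k by (induction k) auto
    then show False using assms that unfolding reaches_root_def by (metis less_irrefl)
  qed
  have "det (parent_mat N f :: 'a mat) = (\<Sum>p\<in>?S. ?g p)"
    by (rule det_def') (simp add: parent_mat_def)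
  also have "\<dots> = (\<Sum>p\<in>{id}. ?g p)"
    by (rule sum.mono_neutral_right)
       (use zero in \<open>auto simp: permutes_id finite_permutations\<close>)
  also have "\<dots> = 1"
    using no_fix by (simp add: parent_mat_def)
  finally show ?thesis .
qed

text \<open>
  The indicator of the set of vertices that never reach \<open>N\<close> lies in the kernel, since a vertex
  belongs to this set if and only if its parent does.
\<close>
lemma det_parent_mat_cyclic:
  assumes "\<not> reaches_root N f" and le: "\<And>i. i < N \<Longrightarrow> f i \<le> N"
  shows "det (parent_mat N f :: 'a :: idom mat) = 0"
proof -
  define C where "C = {i. i < N \<and> (\<forall>k. (f ^^ k) i \<noteq> N)}"
  obtain i0 where i0: "i0 \<in> C"
    using assms(1) by (auto simp: reaches_root_def C_def)
  have inv: "f i \<in> C \<longleftrightarrow> i \<in> C" if "i < N" for i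
  proof
    assume fi: "f i \<in> C"
    have "(f ^^ k) i \<noteq> N" for k
    proof (cases k)
      case 0 then show ?thesis using that by simp
    next
      case (Suc m)
      then show ?thesis using fi by (auto simp: C_def funpow_Suc_right simp del: funpow.simps)
    qed
    then show "i \<in> C" using that by (simp add: C_def)
  next
    assume i: "i \<in> C"
    then have "(f ^^ k) (f i) \<noteq> N" for k
      unfolding C_def by (metis (mono_tags, lifting) comp_apply funpow_Suc_right mem_Collect_eq)
    moreover from this[of 0] have "f i < N" using le[OF that] by simp
    ultimately show "f i \<in> C" by (simp add: C_def)
  qed
  define v :: "'a vec" where "v = vec N (\<lambda>i. of_bool (i \<in> C))"
  have M: "(parent_mat N f :: 'a mat) \<in> carrier_mat N N" by (simp add: parent_mat_def)
  have "v \<in> carrier_vec N" by (simp add: v_def)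
  moreover have "v \<noteq> 0\<^sub>v N"
  proof
    assume "v = 0\<^sub>v N"
    then have "v $ i0 = 0" using i0 by (simp add: C_def)
    then show False using i0 by (simp add: v_def C_def)
  qed
  moreover have "parent_mat N f *\<^sub>v v = 0\<^sub>v N"
  proof (rule eq_vecI)
    fix i assume "i < dim_vec (0\<^sub>v N :: 'a vec)"
    then have i: "i < N" by simp
    have C: "C \<subseteq> {0..<N}" by (auto simp: C_def)
    have "(parent_mat N f *\<^sub>v v) $ i =
        (\<Sum>j=0..<N. (of_bool (i = j) - of_bool (f i = j)) * of_bool (j \<in> C))"
      using i by (simp add: parent_mat_def v_def scalar_prod_def)
    also have "\<dots> = (\<Sum>j=0..<N. of_bool (i = j) * of_bool (j \<in> C)) - (\<Sum>j=0..<N. of_bool (f i = j) * of_bool (j \<in> C))"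
      by (simp add: sum_subtractf left_diff_distrib)
    also have "(\<Sum>j=0..<N. of_bool (i = j) * of_bool (j \<in> C)) = (of_bool (i \<in> C) :: 'a)"
    proof -
      have "(\<Sum>j=0..<N. of_bool (i = j) * of_bool (j \<in> C)) = (\<Sum>j=0..<N. if i = j then of_bool (j \<in> C) else (0::'a))"
        by (intro sum.cong) auto
      then show ?thesis using i by (simp add: sum.delta)
    qed
    also have "(\<Sum>j=0..<N. of_bool (f i = j) * of_bool (j \<in> C)) = (of_bool (f i \<in> C) :: 'a)"
    proof -
      have "(\<Sum>j=0..<N. of_bool (f i = j) * of_bool (j \<in> C)) = (\<Sum>j=0..<N. if f i = j then of_bool (j \<in> C) else (0::'a))"
        by (intro sum.cong) auto
      then show ?thesis using C by (auto simp: sum.delta)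
    qed
    finally show "(parent_mat N f *\<^sub>v v) $ i = 0\<^sub>v N $ i" using inv[OF i] i by simp
  qed (simp add: parent_mat_def)
  ultimately show ?thesis using det_0_iff_vec_prod_zero[OF M] by blast
qed

text \<open>
  Outside \<open>{0..<N}\<close> the maps are the identity, so that the virtual vertex is a fixed point and
  distinct members differ on \<open>{0..<N}\<close>.
\<close>
definition parent_maps :: "nat \<Rightarrow> (nat \<Rightarrow> nat) set" where
  "parent_maps N = {f. (\<forall>i<N. f i \<le> N) \<and> (\<forall>i\<ge>N. f i = i)}"

lemma parent_maps_eq:
  "parent_maps N = {f. (\<forall>i\<in>{0..<N}. f i \<in> {0..N}) \<and> (\<forall>i. i \<notin> {0..<N} \<longrightarrow> f i = i)}"
  by (auto simp: parent_maps_def)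

lemma finite_parent_maps: "finite (parent_maps N)"
  unfolding parent_maps_eq by (rule finite_bounded_functions) auto

text \<open>
  Row \<open>i\<close> is the sum over \<open>k\<close> of \<open>w i k (e\<^sub>i - e\<^sub>k)\<close>, with \<open>e\<^sub>N = 0\<close>. Expanding all rows by
  multilinearity picks one \<open>k\<close> for each row, that is, a parent map, and the remaining determinant
  decides whether this map is a forest. This is the weighted, directed form of the matrix-tree theorem.
\<close>
theorem det_weighted_laplacian_forests:
  fixes w :: "nat \<Rightarrow> nat \<Rightarrow> 'a :: idom"
  shows "det (mat N N (\<lambda>(i, j). (if i = j then \<Sum>k\<le>N. w i k else 0) - w i j)) =
         (\<Sum>f\<in>{f \<in> parent_maps N. reaches_root N f}. \<Prod>i<N. w i (f i))"
proof -
  define a where "a i k = vec N (\<lambda>j. w i k * (of_bool (i = j) - of_bool (k = j)))" for i k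
  let ?F = "{f. (\<forall>i\<in>{0..<N}. f i \<in> {0..N}) \<and> (\<forall>i. i \<notin> {0..<N} \<longrightarrow> f i = i)}"
  have F: "?F = parent_maps N" by (simp only: parent_maps_eq)
  have a: "a \<in> {0..<N} \<rightarrow> {0..N} \<rightarrow> carrier_vec N" by (simp add: a_def)
  have "mat N N (\<lambda>(i, j). (if i = j then \<Sum>k\<le>N. w i k else 0) - w i j) =
        mat\<^sub>r N N (\<lambda>i. finsum_vec TYPE('a) N (a i) {0..N})"
  proof (rule eq_matI)
    fix i j assume ij: "i < dim_row (mat\<^sub>r N N (\<lambda>i. finsum_vec TYPE('a) N (a i) {0..N}))"
       "j < dim_col (mat\<^sub>r N N (\<lambda>i. finsum_vec TYPE('a) N (a i) {0..N}))"
    have "mat\<^sub>r N N (\<lambda>i. finsum_vec TYPE('a) N (a i) {0..N}) $$ (i, j) = (\<Sum>k\<in>{0..N}. a i k $ j)"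
      using ij by simp (subst index_finsum_vec, auto simp: a_def)
    also have "\<dots> = (\<Sum>k\<in>{0..N}. w i k * of_bool (i = j)) - (\<Sum>k\<in>{0..N}. w i k * of_bool (k = j))"
      using ij by (simp add: a_def sum_subtractf right_diff_distrib)
    also have "(\<Sum>k\<in>{0..N}. w i k * of_bool (k = j)) = w i j"
    proof -
      have "(\<Sum>k\<in>{0..N}. w i k * of_bool (k = j)) = (\<Sum>k\<in>{0..N}. if k = j then w i k else 0)"
        by (intro sum.cong) auto
      then show ?thesis using ij by (simp add: sum.delta)
    qed
    finally show "mat N N (\<lambda>(i, j). (if i = j then \<Sum>k\<le>N. w i k else 0) - w i j) $$ (i, j) =
        mat\<^sub>r N N (\<lambda>i. finsum_vec TYPE('a) N (a i) {0..N}) $$ (i, j)"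
      using ij by (simp add: atMost_atLeast0)
  qed auto
  then have "det (mat N N (\<lambda>(i, j). (if i = j then \<Sum>k\<le>N. w i k else 0) - w i j)) =
     (\<Sum>f\<in>?F. det (mat\<^sub>r N N (\<lambda>i. a i (f i))))"
    by (simp only: det_linear_rows_sum[OF finite_atLeastAtMost a])
  also have "\<dots> = (\<Sum>f\<in>parent_maps N. (\<Prod>i<N. w i (f i)) * det (parent_mat N f))"
    unfolding F
  proof (rule sum.cong[OF refl])
    fix f
    have "mat\<^sub>r N N (\<lambda>i. a i (f i)) = mat\<^sub>r N N (\<lambda>i. w i (f i) \<cdot>\<^sub>v row (parent_mat N f) i)"
      by (rule eq_matI) (auto simp: a_def parent_mat_def)
    also have "det \<dots> = (\<Prod>i=0..<N. w i (f i)) * det (mat\<^sub>r N N (row (parent_mat N f)))"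
      by (rule det_rows_mul) (auto simp: parent_mat_def)
    also have "mat\<^sub>r N N (row (parent_mat N f)) = parent_mat N f"
      by (rule eq_matI) (auto simp: parent_mat_def)
    finally show "det (mat\<^sub>r N N (\<lambda>i. a i (f i))) = (\<Prod>i<N. w i (f i)) * det (parent_mat N f)"
      by (simp add: atLeast0LessThan)
  qed
  also have "\<dots> = (\<Sum>f\<in>parent_maps N. if reaches_root N f then \<Prod>i<N. w i (f i) else 0)"
    by (intro sum.cong)
       (auto simp: det_parent_mat_reaching det_parent_mat_cyclic parent_maps_def)
  also have "\<dots> = (\<Sum>f\<in>{f \<in> parent_maps N. reaches_root N f}. \<Prod>i<N. w i (f i))"
    by (rule sum.inter_filter[symmetric, OF finite_parent_maps])
  finally show ?thesis .
qed

section \<open>Spanning trees as parent maps\<close>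

text \<open>
  Being a tree is invariant under injective renaming of the vertices; a cycle in the image is
  pulled back along the inverse of the renaming.
\<close>
lemma is_tree_image:
  assumes inj: "inj_on g V" and T: "T \<subseteq> Pow V" and tree: "is_tree V T"
  shows "is_tree (g ` V) ((`) g ` T)"
proof -
  let ?r = "{(x, y). x \<in> V \<and> y \<in> V \<and> {x, y} \<in> T}"
  let ?r' = "{(x, y). x \<in> g ` V \<and> y \<in> g ` V \<and> {x, y} \<in> (`) g ` T}"
  have conn: "graph_connected V T" and acyc: "\<And>p. \<not> is_cycle T p"
    using tree by (auto simp: is_tree_def)
  have "(g u, g v) \<in> ?r'\<^sup>*" if "(u, v) \<in> ?r\<^sup>*" for u v
    using that
  proof (induction rule: rtrancl_induct)
    case (step y z)
    have "{g y, g z} \<in> (`) g ` T"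
      using step(2) by (intro image_eqI[of _ _ "{y, z}"]) auto
    then have "(g y, g z) \<in> ?r'" using step(2) by auto
    with step(3) show ?case by (rule rtrancl_into_rtrancl)
  qed simp
  then have "graph_connected (g ` V) ((`) g ` T)"
    using conn unfolding graph_connected_def by blast
  moreover have "\<not> is_cycle ((`) g ` T) p" for p
  proof
    assume cyc: "is_cycle ((`) g ` T) p"
    let ?h = "inv_into V g"
    have edge_back: "{?h a, ?h b} \<in> T \<and> a \<in> g ` V \<and> b \<in> g ` V" if ab: "{a, b} \<in> (`) g ` T" for a b
    proof -
      obtain e where e: "e \<in> T" "{a, b} = g ` e" using ab by (rule imageE)
      have eV: "e \<subseteq> V" using e T by auto
      have "?h ` g ` e = e" using inj eV by (rule inv_into_image_cancel)
      then have "{?h a, ?h b} = e" using e(2) by (metis image_empty image_insert)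
      then show ?thesis using e eV by (metis image_mono insert_subset)
    qed
    have sub: "set p \<subseteq> g ` V"
    proof
      fix x assume "x \<in> set p"
      then obtain i where i: "i < length p" "x = p ! i" by (auto simp: in_set_conv_nth)
      show "x \<in> g ` V"
      proof (cases "Suc i < length p")
        case True
        then show ?thesis using cyc edge_back i unfolding is_cycle_def by blast
      next
        case False
        then have "x = last p" using i by (metis last_conv_nth Suc_lessI diff_Suc_1 less_nat_zero_code list.size(3))
        then show ?thesis using cyc edge_back unfolding is_cycle_def by blast
      qed
    qed
    have "is_cycle T (map ?h p)"
      unfolding is_cycle_def
    proof (intro conjI allI impI)
      show "3 \<le> length (map ?h p)" using cyc by (simp add: is_cycle_def)
      show "distinct (map ?h p)"
        using cyc inj_on_subset[OF inj_on_inv_into[OF order_refl] sub]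
        by (simp add: is_cycle_def distinct_map)
      have "p \<noteq> []" using cyc by (auto simp: is_cycle_def)
      then show "{last (map ?h p), hd (map ?h p)} \<in> T"
        using cyc edge_back by (simp add: is_cycle_def last_map hd_map)
      fix i assume "Suc i < length (map ?h p)"
      then show "{map ?h p ! i, map ?h p ! Suc i} \<in> T"
        using cyc edge_back by (simp add: is_cycle_def)
    qed
    then show False using acyc by blast
  qed
  ultimately show ?thesis by (simp add: is_tree_def)
qed

lemma card_spanning_trees_image:
  assumes inj: "inj_on g V" and E: "E \<subseteq> Pow V"
  shows "card (spanning_trees (g ` V) ((`) g ` E)) = card (spanning_trees V E)"
proof -
  have injP: "inj_on ((`) g) E"
    using inj_on_image_Pow[OF inj] E by (rule inj_on_subset)
  have "spanning_trees (g ` V) ((`) g ` E) = (`) ((`) g) ` spanning_trees V E"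
  proof (intro equalityI subsetI)
    fix T' assume T': "T' \<in> spanning_trees (g ` V) ((`) g ` E)"
    then obtain T where T: "T \<subseteq> E" "T' = (`) g ` T"
      unfolding spanning_trees_def by (auto simp: subset_image_iff)
    have "is_tree (inv_into V g ` g ` V) ((`) (inv_into V g) ` T')"
    proof (rule is_tree_image)
      show "inj_on (inv_into V g) (g ` V)" by (rule inj_on_inv_into) simp
      show "T' \<subseteq> Pow (g ` V)" using T E by auto
      show "is_tree (g ` V) T'" using T' by (simp add: spanning_trees_def)
    qed
    moreover have "(`) (inv_into V g) ` T' = T"
    proof -
      have "inv_into V g ` g ` e = e" if "e \<in> T" for e
        using inj that T E by (intro inv_into_image_cancel) auto
      then show ?thesis unfolding T(2) image_image by simp
    qed
    ultimately have "T \<in> spanning_trees V E"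
      using T inj by (simp add: spanning_trees_def inv_into_image_cancel)
    then show "T' \<in> (`) ((`) g) ` spanning_trees V E" using T by blast
  next
    fix T' assume "T' \<in> (`) ((`) g) ` spanning_trees V E"
    then show "T' \<in> spanning_trees (g ` V) ((`) g ` E)"
      using is_tree_image[OF inj] E by (fastforce simp: spanning_trees_def)
  qed
  moreover have "inj_on ((`) ((`) g)) (spanning_trees V E)"
    using inj_on_image_Pow[OF injP] by (rule inj_on_subset) (auto simp: spanning_trees_def)
  ultimately show ?thesis by (simp add: card_image)
qed

definition parent_edges :: "nat \<Rightarrow> (nat \<Rightarrow> nat) \<Rightarrow> nat set set" where
  "parent_edges N f = {{i, f i} |i. i < N \<and> f i < N}"

definition depth :: "nat \<Rightarrow> (nat \<Rightarrow> nat) \<Rightarrow> nat \<Rightarrow> nat" where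
  "depth N f i = (LEAST k. (f ^^ k) i = N)"

lemma depth_parent:
  assumes "reaches_root N f" "i < N"
  shows "depth N f i = Suc (depth N f (f i))"
proof -
  obtain k where "(f ^^ k) i = N" using assms by (auto simp: reaches_root_def)
  then have "(LEAST k. (f ^^ k) i = N) = Suc (LEAST k. (f ^^ Suc k) i = N)"
    by (rule Least_Suc) (use assms in auto)
  then show ?thesis by (simp add: depth_def funpow_Suc_right del: funpow.simps)
qed

text \<open>
  Every vertex climbs to the unique root.
\<close>
lemma parent_edges_connected:
  assumes f: "f \<in> parent_maps N" "reaches_root N f" and \<rho>: "\<rho> < N" 
    and uniq: "\<And>i. i < N \<Longrightarrow> f i = N \<Longrightarrow> i = \<rho>"
  shows "graph_connected {..<N} (parent_edges N f)"
proof -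
  let ?r = "{(x, y). x \<in> {..<N} \<and> y \<in> {..<N} \<and> {x, y} \<in> parent_edges N f}"
  have to_root: "(i, \<rho>) \<in> ?r\<^sup>*" if "i < N" for i
    using that
  proof (induction "depth N f i" arbitrary: i rule: less_induct)
    case less
    show ?case
    proof (cases "f i = N")
      case True
      then show ?thesis using uniq less by simp
    next
      case False
      then have fi: "f i < N" using f(1) less by (auto simp: parent_maps_def le_less)
      then have "(i, f i) \<in> ?r" using less by (auto simp: parent_edges_def)
      moreover have "(f i, \<rho>) \<in> ?r\<^sup>*"
        using less fi depth_parent[OF f(2)] by simp
      ultimately show ?thesis by (rule converse_rtrancl_into_rtrancl)
    qed
  qed
  have "sym ?r" by (auto simp: sym_def insert_commute)
  then have sym: "sym (?r\<^sup>*)" by (rule sym_rtrancl)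
  show ?thesis
    unfolding graph_connected_def
  proof (intro conjI ballI)
    show "{..<N} \<noteq> {}" using \<rho> by auto
    fix u v assume "u \<in> {..<N}" "v \<in> {..<N}"
    then have "(u, \<rho>) \<in> ?r\<^sup>*" "(\<rho>, v) \<in> ?r\<^sup>*" using to_root symD[OF sym] by auto
    then show "(u, v) \<in> ?r\<^sup>*" by (rule rtrancl_trans)
  qed
qed

text \<open>
  On a cycle, a vertex of maximal depth would have its parent as both of its neighbours, but
  these two neighbours are distinct.
\<close>
lemma parent_edges_acyclic:
  assumes f: "reaches_root N f"
  shows "\<not> is_cycle (parent_edges N f) p"
proof
  assume cyc: "is_cycle (parent_edges N f) p"
  let ?n = "length p"
  have n: "?n \<ge> 3" and dist: "distinct p" using cyc by (auto simp: is_cycle_def)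
  have ne: "p \<noteq> []" using n by auto
  \<comment> \<open>Reading indices modulo the length treats the closing edge like the others.\<close>
  have adj: "{p ! i, p ! (Suc i mod ?n)} \<in> parent_edges N f" if "i < ?n" for i
  proof (cases "Suc i < ?n")
    case True
    then show ?thesis using cyc by (simp add: is_cycle_def)
  next
    case False
    then have "?n = Suc i" using that by simp
    moreover from this have "last p = p ! i" "hd p = p ! 0"
      using ne by (simp_all add: last_conv_nth hd_conv_nth)
    ultimately show ?thesis using cyc by (simp add: is_cycle_def)
  qed
  have edge: "y = f x" if "{x, y} \<in> parent_edges N f" "depth N f y \<le> depth N f x" for x y
  proof -
    obtain i where i: "{x, y} = {i, f i}" "i < N" "f i < N"
      using \<open>{x, y} \<in> parent_edges N f\<close> by (auto simp: parent_edges_def)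
    have "depth N f i = Suc (depth N f (f i))" using depth_parent[OF f i(2)] .
    then show ?thesis using i(1) that(2) by (auto simp: doubleton_eq_iff)
  qed
  have fin: "finite (depth N f ` set p)" "depth N f ` set p \<noteq> {}" using ne by auto
  obtain x where x: "x \<in> set p" "depth N f x = Max (depth N f ` set p)"
    using Max_in[OF fin] by auto
  have top: "depth N f y \<le> depth N f x" if "y \<in> set p" for y
    using x fin that by simp
  obtain j where j: "j < ?n" "x = p ! j" using x by (auto simp: in_set_conv_nth)
  let ?a = "Suc j mod ?n"
  \<comment> \<open>\<open>?a\<close> and \<open>b\<close> are the positions after and before \<open>j\<close> on the cycle.\<close>
  define b where "b = (if j = 0 then ?n - 1 else j - 1)"
  have b: "b < ?n" "Suc b mod ?n = j" using n j by (auto simp: b_def)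
  have "p ! ?a = f x"
    using adj[OF j(1)] edge j top n by (metis mod_less_divisor nth_mem b(1) gr_implies_not0 neq0_conv)
  moreover have "p ! b = f x"
    using adj[OF b(1)] edge b j top by (metis nth_mem insert_commute)
  moreover have "?a \<noteq> b"
  proof (cases "Suc j < ?n")
    case True
    then show ?thesis using n by (auto simp: b_def)
  next
    case False
    then have "Suc j = ?n" using j by simp
    then show ?thesis using n by (auto simp: b_def)
  qed
  moreover have "?a < ?n" using n by (intro mod_less_divisor) auto
  ultimately show False using dist b(1) by (metis nth_eq_iff_index_eq)
qed

text \<open>
  The root and the undirected edges determine the orientation of every edge: were the
  edge above \<open>i\<close> reversed in \<open>g\<close>, then \<open>g (f i) = i\<close>, whereas by induction on the depth \<open>g (f i) = f (f i)\<close>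
  lies strictly above \<open>i\<close>.
\<close>
lemma parent_map_unique:
  assumes f: "f \<in> parent_maps N" "reaches_root N f" and g: "g \<in> parent_maps N"
    and root: "\<And>i. i < N \<Longrightarrow> f i = N \<longleftrightarrow> g i = N"
    and eq: "parent_edges N f = parent_edges N g"
  shows "f = g"
proof
  have le: "f i \<le> N" "g i \<le> N" if "i < N" for i using f g that by (auto simp: parent_maps_def)
  have same: "f i = g i" if "i < N" for i
    using that
  proof (induction "depth N f i" arbitrary: i rule: less_induct)
    case less
    show ?case
    proof (cases "f i = N")
      case True
      then show ?thesis using root less by simp
    next
      case False
      then have fi: "f i < N" using le(1)[OF less(2)] by simp
      have IH: "f (f i) = g (f i)" using less fi depth_parent[OF f(2)] by simp
      have "{i, f i} \<in> parent_edges N g"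
        unfolding eq[symmetric] using less fi by (auto simp: parent_edges_def)
      then obtain k where k: "{i, f i} = {k, g k}" "k < N" by (auto simp: parent_edges_def)
      show ?thesis
      proof (cases "k = i")
        case True
        then show ?thesis using k by (auto simp: doubleton_eq_iff)
      next
        case False
        then have "k = f i" "g k = i" using k by (auto simp: doubleton_eq_iff)
        then have "f (f i) = i" using IH by simp
        then have "depth N f (f i) = Suc (depth N f i)" using depth_parent[OF f(2) fi] by simp
        then show ?thesis using depth_parent[OF f(2) less(2)] by simp
      qed
    qed
  qed
  fix i show "f i = g i"
    using same f g by (cases "i < N") (auto simp: parent_maps_def)
qed

lemma rtrancl_simple_path:
  assumes "(u, v) \<in> {(x, y). x \<in> V \<and> y \<in> V \<and> {x, y} \<in> E}\<^sup>*"
  shows "\<exists>p. p \<noteq> [] \<and> hd p = u \<and> last p = v \<and> distinct p \<and> successively (\<lambda>x y. {x, y} \<in> E) p"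
  using assms
proof (induction rule: converse_rtrancl_induct)
  case base
  show ?case by (rule exI[of _ "[v]"]) simp
next
  case (step u w)
  then obtain p where p: "p \<noteq> []" "hd p = w" "last p = v" "distinct p"
    "successively (\<lambda>x y. {x, y} \<in> E) p" by blast
  show ?case
  proof (cases "u \<in> set p")
    case True
    then obtain ys zs where "p = ys @ u # zs" by (meson split_list)
    then show ?thesis using p
      by (intro exI[of _ "u # zs"]) (auto simp: successively_append_iff)
  next
    case False
    then show ?thesis using p step(1)
      by (intro exI[of _ "u # p"]) (auto simp: successively_Cons)
  qed
qed

text \<open>
  Breadth-first search: each vertex picks a neighbour that is closer to the root \<open>\<rho>\<close>. The resulting
  edges already connect everything, so any further edge of the tree would close a cycle.
\<close>
lemma spanning_tree_parent_map:
  assumes E: "\<And>e. e \<in> E \<Longrightarrow> \<exists>u v. u \<noteq> v \<and> e = {u, v} \<and> e \<subseteq> {..<N}"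
    and T: "T \<in> spanning_trees {..<N} E" and \<rho>: "\<rho> < N"
  shows "\<exists>f\<in>parent_maps N. reaches_root N f \<and> (\<forall>i<N. f i = N \<longleftrightarrow> i = \<rho>) \<and> parent_edges N f = T"
proof -
  let ?r = "{(x, y). x \<in> {..<N} \<and> y \<in> {..<N} \<and> {x, y} \<in> T}"
  have TE: "T \<subseteq> E" and conn: "graph_connected {..<N} T" and acyc: "\<And>p. \<not> is_cycle T p"
    using T by (auto simp: spanning_trees_def is_tree_def)
  define dist where "dist i = (LEAST k. (i, \<rho>) \<in> ?r ^^ k)" for i
  have closer: "\<exists>j. (i, j) \<in> ?r \<and> dist j < dist i" if i: "i < N" "i \<noteq> \<rho>" for i
  proof -
    have "(i, \<rho>) \<in> ?r\<^sup>*" using conn i \<rho> unfolding graph_connected_def by blast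
    then have ex: "\<exists>k. (i, \<rho>) \<in> ?r ^^ k" by (simp add: rtrancl_power)
    then have d: "(i, \<rho>) \<in> ?r ^^ dist i" unfolding dist_def by (rule LeastI_ex)
    then obtain m where m: "dist i = Suc m" using i d by (cases "dist i") auto
    then obtain j where "(i, j) \<in> ?r" "(j, \<rho>) \<in> ?r ^^ m" using relpow_Suc_D2[OF d[unfolded m]] by blast
    moreover from this have "dist j \<le> m" unfolding dist_def by (intro Least_le)
    ultimately show ?thesis using m by auto
  qed
  define f where "f i = (if i \<ge> N then i else if i = \<rho> then N else SOME j. (i, j) \<in> ?r \<and> dist j < dist i)" for i
  have f: "(i, f i) \<in> ?r \<and> dist (f i) < dist i" if "i < N" "i \<noteq> \<rho>" for i
    using someI_ex[OF closer[OF that]] that by (simp add: f_def)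
  have pm: "f \<in> parent_maps N"
    using f \<rho> by (force simp: parent_maps_def f_def)
  have f\<rho>: "f \<rho> = N" using \<rho> by (simp add: f_def)
  have root: "\<forall>i<N. f i = N \<longleftrightarrow> i = \<rho>"
    using f f\<rho> by fastforce
  have "\<exists>k. (f ^^ k) i = N" if "i < N" for i
    using that
  proof (induction "dist i" arbitrary: i rule: less_induct)
    case less
    show ?case
    proof (cases "i = \<rho>")
      case True
      then show ?thesis using f\<rho> by (intro exI[of _ 1]) simp
    next
      case False
      then obtain k where "(f ^^ k) (f i) = N" using less f[of i] by blast
      then show ?thesis by (intro exI[of _ "Suc k"]) (simp add: funpow_Suc_right del: funpow.simps)
    qed
  qed
  then have rr: "reaches_root N f" by (simp add: reaches_root_def)
  have sub: "parent_edges N f \<subseteq> T"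
  proof
    fix e assume "e \<in> parent_edges N f"
    then obtain i where i: "e = {i, f i}" "i < N" "f i < N" by (auto simp: parent_edges_def)
    then have "i \<noteq> \<rho>" using f\<rho> by auto
    then show "e \<in> T" using f[of i] i by auto
  qed
  have "T \<subseteq> parent_edges N f"
  proof (rule ccontr)
    assume "\<not> T \<subseteq> parent_edges N f"
    then obtain e where e: "e \<in> T" "e \<notin> parent_edges N f" by blast
    then have "e \<in> E" using TE by blast
    from E[OF this] obtain u v where uv: "u \<noteq> v" "e = {u, v}" "u < N" "v < N" by auto
    have "graph_connected {..<N} (parent_edges N f)"
      using pm rr \<rho> root by (intro parent_edges_connected) auto
    then have path: "(u, v) \<in> {(x, y). x \<in> {..<N} \<and> y \<in> {..<N} \<and> {x, y} \<in> parent_edges N f}\<^sup>*"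
      using uv unfolding graph_connected_def by blast
    obtain p where p: "p \<noteq> []" "hd p = u" "last p = v" "distinct p"
      "successively (\<lambda>x y. {x, y} \<in> parent_edges N f) p" 
      by (rule exE[OF rtrancl_simple_path[OF path]]) blast
    have "length p \<ge> 3"
    proof (rule ccontr)
      assume "\<not> length p \<ge> 3"
      then consider x where "p = [x]" | x y where "p = [x, y]"
        using p(1) by (cases p; cases "tl p"; cases "tl (tl p)") auto
      then show False using p uv e by cases auto
    qed
    moreover have "{last p, hd p} \<in> T" using p uv e by (simp add: insert_commute)
    ultimately have "is_cycle T p"
      using p sub by (auto simp: is_cycle_def successively_conv_nth)
    then show False using acyc by blast
  qed
  then show ?thesis using pm rr root sub by blast
qed

text \<open>
  A parent map with a single root is the same as a spanning tree together with the choice of a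
  vertex as its root.
\<close>
lemma card_single_root_parent_maps:
  assumes E: "\<And>e. e \<in> E \<Longrightarrow> \<exists>u v. u \<noteq> v \<and> e = {u, v} \<and> e \<subseteq> {..<N}"
  shows "card {f \<in> parent_maps N. reaches_root N f \<and> parent_edges N f \<subseteq> E \<and> card {i. i < N \<and> f i = N} = 1}
         = N * card (spanning_trees {..<N} E)" (is "card ?P = _")
proof -
  define root where "root f = (THE i. i < N \<and> f i = N)" for f :: "nat \<Rightarrow> nat"
  have root: "root f < N \<and> (\<forall>i<N. f i = N \<longleftrightarrow> i = root f)" if one: "card {i. i < N \<and> f i = N} = 1" for f
  proof -
    obtain \<rho> where \<rho>: "{i. i < N \<and> f i = N} = {\<rho>}" using one by (rule card_1_singletonE)
    then have "root f = \<rho>" unfolding root_def by (intro the_equality) auto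
    then show ?thesis using \<rho> by auto
  qed
  have "bij_betw (\<lambda>f. (root f, parent_edges N f)) ?P ({..<N} \<times> spanning_trees {..<N} E)"
    unfolding bij_betw_def
  proof
    show "inj_on (\<lambda>f. (root f, parent_edges N f)) ?P"
    proof (rule inj_onI)
      fix f g assume f: "f \<in> ?P" and g: "g \<in> ?P"
        and eq: "(root f, parent_edges N f) = (root g, parent_edges N g)"
      show "f = g"
      proof (rule parent_map_unique[of f N g])
        have rfg: "root f = root g" using eq by simp
        have "\<forall>i<N. f i = N \<longleftrightarrow> i = root f" "\<forall>i<N. g i = N \<longleftrightarrow> i = root g"
          using root[of f] f root[of g] g by blast+
        then show "f i = N \<longleftrightarrow> g i = N" if "i < N" for i
          using that unfolding rfg by blast
      qed (use f g eq in simp_all)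
    qed
    show "(\<lambda>f. (root f, parent_edges N f)) ` ?P = {..<N} \<times> spanning_trees {..<N} E"
    proof (intro equalityI subsetI)
      fix z assume "z \<in> (\<lambda>f. (root f, parent_edges N f)) ` ?P"
      then obtain f where f: "f \<in> ?P" "z = (root f, parent_edges N f)" by blast
      have "graph_connected {..<N} (parent_edges N f)"
        by (rule parent_edges_connected[of f N "root f"]) (use f root[of f] in blast)+
      moreover have "\<not> is_cycle (parent_edges N f) p" for p
        using f parent_edges_acyclic[of N f] by blast
      ultimately have "parent_edges N f \<in> spanning_trees {..<N} E"
        using f unfolding spanning_trees_def is_tree_def by blast
      then show "z \<in> {..<N} \<times> spanning_trees {..<N} E"
        using f(2) root[of f] f(1) by blast
    next
      fix z assume "z \<in> {..<N} \<times> spanning_trees {..<N} E"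
      then obtain \<rho> T where z: "z = (\<rho>, T)" "\<rho> < N" "T \<in> spanning_trees {..<N} E" by auto
      obtain f where f: "f \<in> parent_maps N" "reaches_root N f" "\<forall>i<N. f i = N \<longleftrightarrow> i = \<rho>" "parent_edges N f = T"
        using spanning_tree_parent_map[OF E z(3,2)] by blast
      have "{i. i < N \<and> f i = N} = {\<rho>}" using f z by auto
      then have one: "card {i. i < N \<and> f i = N} = 1" by simp
      from root[OF this] have "root f = \<rho>" using f(3) by blast
      then have "z = (root f, parent_edges N f)" using f(4) z(1) by simp
      moreover have "f \<in> ?P" using f one z(3) unfolding spanning_trees_def by blast
      ultimately show "z \<in> (\<lambda>f. (root f, parent_edges N f)) ` ?P" by (rule image_eqI)
    qed
  qed
  then have "card ?P = card ({..<N} \<times> spanning_trees {..<N} E)" by (rule bij_betw_same_card)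
  then show ?thesis by (simp add: card_cartesian_product)
qed

text \<open>
  The matrix-tree theorem without eigenvalues or minors. Giving the virtual vertex the edge weight
  \<open>x\<close> turns \<open>det_weighted_laplacian_forests\<close> into a polynomial in \<open>x\<close> that counts rooted forests by
  their number of roots. There is always at least one root, and forests with exactly one root survive in the
  limit.
\<close>
theorem matrix_tree_limit:
  assumes E: "\<And>e. e \<in> E \<Longrightarrow> \<exists>u v. u \<noteq> v \<and> e = {u, v} \<and> e \<subseteq> {..<N}" and N: "N > 0"
  shows "((\<lambda>x. det (mat N N (\<lambda>(i, j). (if i = j then x + of_nat (card {k. k < N \<and> {i, k} \<in> E}) else 0)
              - of_bool ({i, j} \<in> E))) / x)
          \<longlongrightarrow> (of_nat (N * card (spanning_trees {..<N} E)) :: complex)) (at 0)"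
proof -
  let ?R = "{f \<in> parent_maps N. reaches_root N f}"
  let ?RE = "{f \<in> ?R. parent_edges N f \<subseteq> E}"
  let ?K = "\<lambda>f. card {i. i < N \<and> f i = N}"
  let ?L = "\<lambda>x::complex. mat N N (\<lambda>(i, j). (if i = j then x + of_nat (card {k. k < N \<and> {i, k} \<in> E}) else 0)
              - of_bool ({i, j} \<in> E))"
  have fin: "finite ?R"
    using finite_parent_maps by simp
  have K: "?K f \<noteq> 0" if "f \<in> ?R" for f
  proof
    assume "?K f = 0"
    then have no: "f i \<noteq> N" if "i < N" for i using that by (auto simp: card_eq_0_iff)
    have "(f ^^ k) 0 < N" for k
    proof (induction k)
      case 0 then show ?case using N by simp
    next
      case (Suc k)
      then show ?case using no[of "(f ^^ k) 0"] \<open>f \<in> ?R\<close> by (auto simp: parent_maps_def le_less)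
    qed
    then show False using \<open>f \<in> ?R\<close> N unfolding reaches_root_def by (auto dest!: spec[of _ 0]) (metis less_irrefl)
  qed
  have det: "det (?L x) = x * (\<Sum>f\<in>?RE. x ^ (?K f - 1))" for x
  proof -
    \<comment> \<open>Every vertex is joined to the virtual vertex \<open>N\<close> by an edge of weight \<open>x\<close>.\<close>
    define w where "w i k = (if k = N then x else of_bool ({i, k} \<in> E))" for i k
    have "?L x = mat N N (\<lambda>(i, j). (if i = j then \<Sum>k\<le>N. w i k else 0) - w i j)"
    proof (rule cong_mat)
      fix i j assume ij: "i < N" "j < N"
      have "(\<Sum>k\<le>N. w i k) = x + (\<Sum>k<N. of_bool ({i, k} \<in> E))"
        by (simp add: lessThan_Suc_atMost[symmetric] w_def)
      also have "(\<Sum>k<N. of_bool ({i, k} \<in> E)) = (of_nat (card {k. k < N \<and> {i, k} \<in> E}) :: complex)"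
        by (simp add: sum.If_cases of_bool_def lessThan_def Collect_conj_eq[symmetric])
      finally have "(\<Sum>k\<le>N. w i k) = x + of_nat (card {k. k < N \<and> {i, k} \<in> E})" .
      moreover have "w i j = of_bool ({i, j} \<in> E)" using ij by (simp add: w_def)
      ultimately show "(case (i, j) of (i, j) \<Rightarrow> (if i = j then x + of_nat (card {k. k < N \<and> {i, k} \<in> E}) else 0)
              - of_bool ({i, j} \<in> E)) = (case (i, j) of (i, j) \<Rightarrow> (if i = j then \<Sum>k\<le>N. w i k else 0) - w i j)"
        by auto
    qed auto
    then have "det (?L x) = (\<Sum>f\<in>?R. \<Prod>i<N. w i (f i))"
      by (simp only: det_weighted_laplacian_forests)
    also have "\<dots> = (\<Sum>f\<in>?R. if parent_edges N f \<subseteq> E then x * x ^ (?K f - 1) else 0)"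
    proof (rule sum.cong[OF refl])
      fix f assume f: "f \<in> ?R"
      show "(\<Prod>i<N. w i (f i)) = (if parent_edges N f \<subseteq> E then x * x ^ (?K f - 1) else 0)"
      proof (cases "parent_edges N f \<subseteq> E")
        case True
        have "(\<Prod>i<N. w i (f i)) = (\<Prod>i<N. if f i = N then x else 1)"
        proof (rule prod.cong[OF refl])
          fix i assume i: "i \<in> {..<N}"
          show "w i (f i) = (if f i = N then x else 1)"
          proof (cases "f i = N")
            case False
            then have "f i < N" using f i by (auto simp: parent_maps_def le_less)
            then have "{i, f i} \<in> E" using True i by (auto simp: parent_edges_def)
            then show ?thesis using False by (simp add: w_def)
          qed (simp add: w_def)
        qed
        also have "\<dots> = x ^ ?K f"
          by (simp add: prod.If_cases lessThan_def Collect_conj_eq[symmetric])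
        finally show ?thesis using True K[OF f] by (cases "?K f") auto
      next
        case False
        then obtain i where i: "i < N" "f i < N" "{i, f i} \<notin> E" by (auto simp: parent_edges_def)
        then have "w i (f i) = 0" by (simp add: w_def)
        then have "(\<Prod>i<N. w i (f i)) = 0" using i by (intro prod_zero) auto
        then show ?thesis using False by simp
      qed
    qed
    also have "\<dots> = (\<Sum>f\<in>?RE. x * x ^ (?K f - 1))"
      using fin by (rule sum.inter_filter[symmetric])
    finally show ?thesis by (simp add: sum_distrib_left)
  qed
  have "((\<lambda>x::complex. \<Sum>f\<in>?RE. x ^ (?K f - 1)) \<longlongrightarrow> (\<Sum>f\<in>?RE. 0 ^ (?K f - 1))) (at 0)"
    by (intro tendsto_intros)
  also have "(\<Sum>f\<in>?RE. 0 ^ (?K f - 1)) = (\<Sum>f\<in>?RE. if ?K f = 1 then 1 else (0::complex))"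
  proof (rule sum.cong[OF refl])
    fix f assume "f \<in> ?RE"
    then have "?K f \<noteq> 0" using K by blast
    then show "0 ^ (?K f - 1) = (if ?K f = 1 then 1 else (0::complex))"
      by (auto simp add: power_0_left simp del: card_0_eq card_eq_0_iff)
  qed
  also have "\<dots> = of_nat (card {f \<in> ?RE. ?K f = 1})"
  proof -
    have "finite ?RE" by (rule finite_subset[OF _ fin]) blast
    from sum.inter_filter[OF this, of "\<lambda>_. 1::complex" "\<lambda>f. ?K f = 1"] show ?thesis by simp
  qed
  also have "{f \<in> ?RE. ?K f = 1} = {f \<in> parent_maps N. reaches_root N f \<and> parent_edges N f \<subseteq> E \<and> ?K f = 1}"
    by blast
  also have "card \<dots> = N * card (spanning_trees {..<N} E)"
    by (rule card_single_root_parent_maps[OF E])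
  finally have lim: "((\<lambda>x. \<Sum>f\<in>?RE. x ^ (?K f - 1)) \<longlongrightarrow> (of_nat (N * card (spanning_trees {..<N} E)) :: complex)) (at 0)" .
  show ?thesis
    by (rule Lim_transform_eventually[OF lim]) (auto simp: det eventually_at_filter)
qed

section \<open>The dihedral Cayley graph on an initial segment of the naturals\<close>

lemma dih_conn_set_eq:
  assumes "n > 0"
  shows "dih_conn_set s t \<beta> \<gamma> n =
    (\<Union>i\<in>{1..s}. {(False, int (\<beta> i) mod int n), (False, (- int (\<beta> i)) mod int n)}) \<union>
    (\<lambda>i. (True, int (\<gamma> i) mod int n)) ` {1..t}"
  unfolding dih_conn_set_def using assms
  by (simp add: dih_b_int_pow del: One_nat_def) (simp add: dihedral_def dih_a_def del: One_nat_def)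

text \<open>
  Characters of the cyclic group are well defined on residues modulo \<open>n\<close>.
\<close>
lemma power_int_mod_root_of_unity:
  assumes "(z::complex) ^ n = 1"
  shows "z powi (k mod int n) = z powi k"
proof (cases "n = 0")
  case False
  then have z: "z \<noteq> 0" using assms by (auto simp: power_0_left)
  have "z powi k = z powi (int n * (k div int n) + k mod int n)" by simp
  also have "\<dots> = z powi (int n * (k div int n)) * z powi (k mod int n)"
    by (rule power_int_add) (use z in simp)
  also have "z powi (int n * (k div int n)) = 1"
    using assms by (simp add: power_int_mult)
  finally show ?thesis by simp
qed simp

text \<open>
  For \<open>n\<close> beyond \<open>2 \<beta>\<^sub>s\<close> and \<open>\<gamma>\<^sub>t\<close> the listed generators are pairwise distinct.
\<close>
lemma sum_dih_conn_set:
  fixes h :: "bool \<times> int \<Rightarrow> 'a :: comm_monoid_add"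
  assumes \<beta>: "\<And>i. i \<in> {1..s} \<Longrightarrow> 0 < \<beta> i \<and> 2 * \<beta> i < n" and inj\<beta>: "inj_on \<beta> {1..s}"
    and \<gamma>: "\<And>i. i \<in> {1..t} \<Longrightarrow> \<gamma> i < n" and inj\<gamma>: "inj_on \<gamma> {1..t}" and n: "n > 0"
  shows "(\<Sum>x\<in>dih_conn_set s t \<beta> \<gamma> n. h x) =
    (\<Sum>i=1..s. h (False, int (\<beta> i) mod int n) + h (False, (- int (\<beta> i)) mod int n)) +
    (\<Sum>i=1..t. h (True, int (\<gamma> i) mod int n))"
proof -
  let ?p = "\<lambda>i. (False, int (\<beta> i) mod int n)" and ?m = "\<lambda>i. (False, (- int (\<beta> i)) mod int n)"
  let ?g = "\<lambda>i. (True, int (\<gamma> i) mod int n)"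
  have p: "int (\<beta> i) mod int n = int (\<beta> i)" if "i \<in> {1..s}" for i
    using \<beta>[OF that] by simp
  have m: "(- int (\<beta> i)) mod int n = int n - int (\<beta> i)" if "i \<in> {1..s}" for i
    using \<beta>[OF that] by (simp add: zmod_zminus1_eq_if)
  have g: "int (\<gamma> i) mod int n = int (\<gamma> i)" if "i \<in> {1..t}" for i
    using \<gamma>[OF that] by simp
  have S: "dih_conn_set s t \<beta> \<gamma> n = (?p ` {1..s} \<union> ?m ` {1..s}) \<union> ?g ` {1..t}"
    unfolding dih_conn_set_eq[OF n] by blast
  have ip: "inj_on ?p {1..s}"
  proof (rule inj_onI)
    fix i j assume "i \<in> {1..s}" "j \<in> {1..s}" "?p i = ?p j"
    then show "i = j" using inj_onD[OF inj\<beta>, of i j] p[of i] p[of j] by simp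
  qed
  have im: "inj_on ?m {1..s}"
  proof (rule inj_onI)
    fix i j assume "i \<in> {1..s}" "j \<in> {1..s}" "?m i = ?m j"
    then show "i = j" using inj_onD[OF inj\<beta>, of i j] m[of i] m[of j] by simp
  qed
  have ig: "inj_on ?g {1..t}"
  proof (rule inj_onI)
    fix i j assume "i \<in> {1..t}" "j \<in> {1..t}" "?g i = ?g j"
    then show "i = j" using inj_onD[OF inj\<gamma>, of i j] g[of i] g[of j] by simp
  qed
  have "?p i \<noteq> ?m j" if "i \<in> {1..s}" "j \<in> {1..s}" for i j
  proof
    assume "?p i = ?m j"
    then have "int (\<beta> i) = int n - int (\<beta> j)" using p[OF that(1)] m[OF that(2)] by simp
    then show False using \<beta>[OF that(1)] \<beta>[OF that(2)] by linarith
  qed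
  then have pm: "?p ` {1..s} \<inter> ?m ` {1..s} = {}" by blast
  have pmg: "(?p ` {1..s} \<union> ?m ` {1..s}) \<inter> ?g ` {1..t} = {}" by blast
  have "(\<Sum>x\<in>dih_conn_set s t \<beta> \<gamma> n. h x) =
      (\<Sum>x\<in>?p ` {1..s} \<union> ?m ` {1..s}. h x) + (\<Sum>x\<in>?g ` {1..t}. h x)"
    unfolding S by (rule sum.union_disjoint[OF _ _ pmg]) auto
  also have "(\<Sum>x\<in>?p ` {1..s} \<union> ?m ` {1..s}. h x) = (\<Sum>x\<in>?p ` {1..s}. h x) + (\<Sum>x\<in>?m ` {1..s}. h x)"
    by (rule sum.union_disjoint[OF _ _ pm]) auto
  finally show ?thesis
    by (simp only: sum.reindex[OF ip] sum.reindex[OF im] sum.reindex[OF ig] comp_def sum.distrib)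
qed

text \<open>
  The rotations \<open>b\<^sup>i\<close> come first and the reflections \<open>a b\<^sup>-\<^sup>i\<close> follow. Since
  \<open>b\<^sup>k a b\<^sup>\<gamma> = a b\<^bsup>\<gamma> - k\<^esup>\<close>, reversing the exponents of the reflections makes every generator act on the
  indices as a translation modulo \<open>n\<close>, up to exchanging the two blocks. This turns the blocks of the adjacency matrix into circulants. As
  \<open>i\<close> and \<open>i - n\<close> agree modulo \<open>n\<close>, the index itself can be used in the second block.
\<close>
definition dih_vertex :: "nat \<Rightarrow> nat \<Rightarrow> bool \<times> int" where
  "dih_vertex n i = (if i < n then (False, int i) else (True, (- int i) mod int n))"

text \<open>
  The inverse of \<open>dih_vertex\<close>.
\<close>
definition dih_index :: "nat \<Rightarrow> bool \<times> int \<Rightarrow> nat" where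
  "dih_index n = (\<lambda>(e, k). if e then n + nat ((- k) mod int n) else nat k)"

lemma dih_index_less: "y \<in> carrier (dihedral n) \<Longrightarrow> dih_index n y < 2 * n"
  by (auto simp: dih_index_def dihedral_def nat_less_iff split: prod.splits)

lemma dih_vertex_carrier: "n > 0 \<Longrightarrow> dih_vertex n i \<in> carrier (dihedral n)"
  by (auto simp: dih_vertex_def dihedral_def)

lemma dih_index_vertex:
  assumes "n > 0" "i < 2 * n"
  shows "dih_index n (dih_vertex n i) = i"
proof (cases "i < n")
  case False
  then have "int i mod int n = int (i - n)"
    using assms by (simp add: of_nat_diff mod_pos_pos_trivial le_mod_geq flip: of_nat_mod)
  then show ?thesis using False
    by (simp add: dih_vertex_def dih_index_def mod_simps)
qed (simp add: dih_vertex_def dih_index_def)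

lemma dih_vertex_index:
  assumes "y \<in> carrier (dihedral n)"
  shows "dih_vertex n (dih_index n y) = y"
proof -
  obtain e k where y: "y = (e, k)" "0 \<le> k" "k < int n" using assms by (auto simp: dihedral_def)
  then have "int n > 0" by simp
  show ?thesis
  proof (cases e)
    case True
    have "(- (int n + (- k) mod int n)) mod int n = k"
      using y by (simp add: mod_simps)
    then show ?thesis using True y \<open>int n > 0\<close>
      by (simp add: dih_vertex_def dih_index_def)
  next
    case False
    then show ?thesis using y by (simp add: dih_vertex_def dih_index_def nat_less_iff)
  qed
qed

lemma dih_index_bij:
  assumes "n > 0"
  shows "inj_on (dih_index n) (carrier (dihedral n))"
    and "dih_index n ` carrier (dihedral n) = {..<2 * n}"
proof -
  show "inj_on (dih_index n) (carrier (dihedral n))"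
    by (metis dih_vertex_index inj_onI)
  show "dih_index n ` carrier (dihedral n) = {..<2 * n}"
    using dih_index_vertex[OF assms] dih_vertex_carrier[OF assms] dih_index_less
    by (metis (no_types, lifting) image_eqI image_subsetI lessThan_iff subsetI subset_antisym)
qed

definition dih_index_edges :: "nat \<Rightarrow> nat \<Rightarrow> (nat \<Rightarrow> nat) \<Rightarrow> (nat \<Rightarrow> nat) \<Rightarrow> nat \<Rightarrow> nat set set" where
  "dih_index_edges s t \<beta> \<gamma> n = (`) (dih_index n) ` dih_graph_edges s t \<beta> \<gamma> n"

lemma dih_graph_edges_subset: "dih_graph_edges s t \<beta> \<gamma> n \<subseteq> Pow (carrier (dihedral n))"
  by (auto simp: dih_graph_edges_def cayley_edges_def)

lemma dih_tau_index:
  assumes "n > 0"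
  shows "dih_tau s t \<beta> \<gamma> n = card (spanning_trees {..<2 * n} (dih_index_edges s t \<beta> \<gamma> n))"
  using card_spanning_trees_image[OF dih_index_bij(1)[OF assms] dih_graph_edges_subset]
  by (simp add: dih_tau_def dih_index_edges_def dih_index_bij(2)[OF assms])

context
  fixes s t n :: nat and \<beta> \<gamma> :: "nat \<Rightarrow> nat"
  assumes \<beta>: "\<And>i. i \<in> {1..s} \<Longrightarrow> 0 < \<beta> i \<and> 2 * \<beta> i < n" and inj\<beta>: "inj_on \<beta> {1..s}"
    and \<gamma>: "\<And>i. i \<in> {1..t} \<Longrightarrow> \<gamma> i < n" and inj\<gamma>: "inj_on \<gamma> {1..t}" and n: "n > 0"
begin

lemma dih_index_edges_simple:
  assumes "e \<in> dih_index_edges s t \<beta> \<gamma> n"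
  shows "\<exists>u v. u \<noteq> v \<and> e = {u, v} \<and> e \<subseteq> {..<2 * n}"
proof -
  obtain f where f: "f \<in> dih_graph_edges s t \<beta> \<gamma> n" "e = dih_index n ` f"
    using assms unfolding dih_index_edges_def by blast
  then obtain g h where gh: "f = {g, h}"
    by (auto simp: dih_graph_edges_def cayley_edges_def)
  have "g \<noteq> h" using dih_graph_edges_iff(2)[where s = s and \<beta> = \<beta>, OF n \<beta>] f(1) gh by blast
  moreover have "g \<in> carrier (dihedral n)" "h \<in> carrier (dihedral n)"
    using dih_graph_edges_subset f(1) gh by blast+
  ultimately show ?thesis
    using f(2) gh dih_index_bij(1)[OF n] dih_index_less
    by (intro exI[of _ "dih_index n g"] exI[of _ "dih_index n h"]) (auto dest: inj_onD)
qed

lemma dih_index_edges_iff: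
  assumes "i < 2 * n" "k < 2 * n"
  shows "{i, k} \<in> dih_index_edges s t \<beta> \<gamma> n \<longleftrightarrow>
    (\<exists>x\<in>dih_conn_set s t \<beta> \<gamma> n. k = dih_index n (dih_vertex n i \<otimes>\<^bsub>dihedral n\<^esub> x))"
    (is "?l \<longleftrightarrow> ?r")
proof -
  note grp = dihedral_group[OF n]
  note m_closed = monoid.m_closed[OF group.is_monoid[OF grp]]
  have S: "dih_conn_set s t \<beta> \<gamma> n \<subseteq> carrier (dihedral n)"
    unfolding dih_conn_set_eq[OF n] using n by (auto simp: dihedral_def)
  have "?l \<longleftrightarrow> {dih_vertex n i, dih_vertex n k} \<in> dih_graph_edges s t \<beta> \<gamma> n"
  proof
    assume ?l
    then obtain f where f: "f \<in> dih_graph_edges s t \<beta> \<gamma> n" "{i, k} = dih_index n ` f"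
      unfolding dih_index_edges_def by blast
    have "dih_vertex n ` {i, k} = f"
      unfolding f(2) image_image using f(1) dih_graph_edges_subset[of s t \<beta> \<gamma> n] dih_vertex_index
      by force
    then show "{dih_vertex n i, dih_vertex n k} \<in> dih_graph_edges s t \<beta> \<gamma> n" using f(1) by simp
  next
    assume "{dih_vertex n i, dih_vertex n k} \<in> dih_graph_edges s t \<beta> \<gamma> n"
    then have "dih_index n ` {dih_vertex n i, dih_vertex n k} \<in> dih_index_edges s t \<beta> \<gamma> n"
      unfolding dih_index_edges_def by blast
    then show ?l using dih_index_vertex[OF n] assms by simp
  qed
  also have "\<dots> \<longleftrightarrow> (\<exists>x\<in>dih_conn_set s t \<beta> \<gamma> n. dih_vertex n k = dih_vertex n i \<otimes>\<^bsub>dihedral n\<^esub> x)"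
    using dih_graph_edges_iff(1)[where s = s and \<beta> = \<beta>, OF n \<beta>] dih_vertex_carrier[OF n] by blast
  also have "\<dots> \<longleftrightarrow> ?r"
  proof (rule bex_cong[OF refl])
    fix x assume "x \<in> dih_conn_set s t \<beta> \<gamma> n"
    then have "dih_vertex n i \<otimes>\<^bsub>dihedral n\<^esub> x \<in> carrier (dihedral n)"
      using S dih_vertex_carrier[OF n] m_closed by blast
    then show "dih_vertex n k = dih_vertex n i \<otimes>\<^bsub>dihedral n\<^esub> x \<longleftrightarrow>
        k = dih_index n (dih_vertex n i \<otimes>\<^bsub>dihedral n\<^esub> x)"
      using dih_vertex_index dih_index_vertex[OF n assms(2)] by metis
  qed
  finally show ?thesis .
qed

text \<open>
  The neighbours of a vertex correspond bijectively to the generators, by cancellation in the group.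
\<close>
lemma sum_dih_neighbours:
  fixes y :: "nat \<Rightarrow> complex"
  assumes i: "i < 2 * n"
  shows "(\<Sum>k<2 * n. of_bool ({i, k} \<in> dih_index_edges s t \<beta> \<gamma> n) * y k) =
    (\<Sum>x\<in>dih_conn_set s t \<beta> \<gamma> n. y (dih_index n (dih_vertex n i \<otimes>\<^bsub>dihedral n\<^esub> x)))"
proof -
  note grp = dihedral_group[OF n]
  note m_closed = monoid.m_closed[OF group.is_monoid[OF grp]]
  let ?S = "dih_conn_set s t \<beta> \<gamma> n"
  let ?f = "\<lambda>x. dih_index n (dih_vertex n i \<otimes>\<^bsub>dihedral n\<^esub> x)"
  have S: "?S \<subseteq> carrier (dihedral n)"
    unfolding dih_conn_set_eq[OF n] using n by (auto simp: dihedral_def)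
  have v: "dih_vertex n i \<in> carrier (dihedral n)" using dih_vertex_carrier[OF n] .
  have inj: "inj_on ?f ?S"
  proof (rule inj_onI)
    fix x x' assume x: "x \<in> ?S" "x' \<in> ?S" and eq: "?f x = ?f x'"
    have "dih_vertex n i \<otimes>\<^bsub>dihedral n\<^esub> x = dih_vertex n i \<otimes>\<^bsub>dihedral n\<^esub> x'"
      using inj_onD[OF dih_index_bij(1)[OF n] eq] x S v m_closed by blast
    then show "x = x'" using x S v monoid.Units_l_cancel[OF group.is_monoid[OF grp]] group.Units_eq[OF grp] by blast
  qed
  have fS: "?f ` ?S \<subseteq> {..<2 * n}" using S v dih_index_less m_closed by blast
  have "(\<Sum>k<2 * n. of_bool ({i, k} \<in> dih_index_edges s t \<beta> \<gamma> n) * y k) =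
      (\<Sum>k\<in>{..<2 * n}. if k \<in> ?f ` ?S then y k else 0)"
    using dih_index_edges_iff[OF i] by (intro sum.cong) auto
  also have "\<dots> = (\<Sum>k\<in>?f ` ?S. y k)"
    using fS by (simp add: sum.inter_restrict[symmetric] Int_absorb1)
  also have "\<dots> = (\<Sum>x\<in>?S. y (?f x))"
    using inj by (simp add: sum.reindex)
  finally show ?thesis .
qed

text \<open>
  The graph is regular: \<open>sum_dih_neighbours\<close> is applied to the constant function \<open>1\<close>.
\<close>
lemma card_dih_neighbours:
  assumes i: "i < 2 * n"
  shows "card {k. k < 2 * n \<and> {i, k} \<in> dih_index_edges s t \<beta> \<gamma> n} = 2 * s + t"
proof -
  have "(of_nat (card {k. k < 2 * n \<and> {i, k} \<in> dih_index_edges s t \<beta> \<gamma> n}) :: complex) =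
      (\<Sum>k<2 * n. of_bool ({i, k} \<in> dih_index_edges s t \<beta> \<gamma> n) * 1)"
    by (simp add: sum.If_cases of_bool_def lessThan_def Collect_conj_eq[symmetric])
  also have "\<dots> = of_nat (2 * s + t)"
    unfolding sum_dih_neighbours[OF i]
    by (subst sum_dih_conn_set[OF \<beta> inj\<beta> \<gamma> inj\<gamma> n]) simp_all
  finally show ?thesis by (simp only: of_nat_eq_iff)
qed

text \<open>
  The vectors supported on one of the two blocks, where they equal the character \<open>k \<mapsto> z\<^sup>k\<close>, span a
  space invariant under adjacency. Rotations act diagonally on it, and reflections swap the blocks with
  the factor \<open>\<Sum> z\<^bsup>\<plusminus>\<gamma>\<^esup>\<close>; the sign depends on whether the edge starts at
  a rotation or at a reflection.
\<close>
lemma dih_adjacency_on_characters: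
  fixes z :: complex
  assumes z: "z ^ n = 1" and i: "i < 2 * n"
  shows "(\<Sum>k<2 * n. of_bool ({i, k} \<in> dih_index_edges s t \<beta> \<gamma> n) * (of_bool ((k < n) = \<sigma>) * z ^ k)) =
    z ^ i * (if (i < n) = \<sigma> then 2 * of_nat s + of_nat t - laurent_A s t \<beta> z
             else - laurent_B t \<gamma> (if i < n then inverse z else z))"
proof -
  have z0: "z \<noteq> 0" using z n by (auto simp: power_0_left)
  have powi_nat: "z powi int (nat (l mod int n)) = z powi (l mod int n)" for l
  proof -
    have "0 \<le> l mod int n" using n by (intro pos_mod_sign) simp
    then show ?thesis by (simp only: int_nat_eq if_True)
  qed
  let ?y = "\<lambda>k. of_bool ((k < n) = \<sigma>) * z ^ k"
  have y: "?y (dih_index n (e, k mod int n)) =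
      of_bool ((\<not> e) = \<sigma>) * z powi (if e then - k else k)" for e k
  proof (cases e)
    case True
    have "z ^ (n + nat ((- (k mod int n)) mod int n)) = z powi int (nat ((- (k mod int n)) mod int n))"
      by (simp only: power_add z power_int_of_nat mult_1)
    also have "\<dots> = z powi ((- (k mod int n)) mod int n)" by (rule powi_nat)
    also have "\<dots> = z powi (- k)" by (simp only: mod_minus_eq power_int_mod_root_of_unity[OF z])
    finally show ?thesis using True by (simp add: dih_index_def)
  next
    case False
    have "z ^ nat (k mod int n) = z powi int (nat (k mod int n))" by (simp only: power_int_of_nat)
    also have "\<dots> = z powi (k mod int n)" by (rule powi_nat)
    finally show ?thesis using False n
      by (simp add: dih_index_def power_int_mod_root_of_unity[OF z] nat_less_iff)
  qed
  define e k where "e = (\<not> i < n)" and "k = (if i < n then int i else (- int i) mod int n)"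
  have v: "dih_vertex n i = (e, k)" by (simp add: dih_vertex_def e_def k_def)
  have zi: "z powi (if e then - k else k) = z ^ i"
  proof (cases "i < n")
    case False
    have "z powi (- ((- int i) mod int n)) = z powi ((- ((- int i) mod int n)) mod int n)"
      by (simp only: power_int_mod_root_of_unity[OF z])
    also have "\<dots> = z powi (int i)" by (simp only: mod_minus_eq power_int_mod_root_of_unity[OF z] minus_minus)
    finally show ?thesis using False by (simp add: e_def k_def)
  qed (simp add: e_def k_def)
  have rot: "dih_vertex n i \<otimes>\<^bsub>dihedral n\<^esub> (False, l mod int n) = (e, (k + l) mod int n)" for l
    by (simp add: v dihedral_def mod_simps)
  have ref: "dih_vertex n i \<otimes>\<^bsub>dihedral n\<^esub> (True, l mod int n) = (\<not> e, (l - k) mod int n)" for l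
    by (simp add: v dihedral_def mod_simps)
  have "(\<Sum>k<2 * n. of_bool ({i, k} \<in> dih_index_edges s t \<beta> \<gamma> n) * ?y k) =
     (\<Sum>j=1..s. of_bool ((\<not> e) = \<sigma>) * z powi (if e then - (k + int (\<beta> j)) else (k + int (\<beta> j))) +
        of_bool ((\<not> e) = \<sigma>) * z powi (if e then - (k + - int (\<beta> j)) else (k + - int (\<beta> j)))) +
     (\<Sum>j=1..t. of_bool (e = \<sigma>) * z powi (if \<not> e then - (int (\<gamma> j) - k) else int (\<gamma> j) - k))"
    unfolding sum_dih_neighbours[OF i]
    by (subst sum_dih_conn_set[OF \<beta> inj\<beta> \<gamma> inj\<gamma> n]) (simp_all only: rot ref y not_not)
  also have "\<dots> = z ^ i * (if (\<not> e) = \<sigma> then (\<Sum>j=1..s. z powi int (\<beta> j) + z powi (- int (\<beta> j)))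
      else (\<Sum>j=1..t. z powi (if e then int (\<gamma> j) else - int (\<gamma> j))))"
    unfolding zi[symmetric] using z0
    by (cases e; cases \<sigma>)
       (simp_all add: sum_distrib_left power_int_add power_int_diff power_int_minus field_simps)
  also have "\<dots> = z ^ i * (if (i < n) = \<sigma> then 2 * of_nat s + of_nat t - laurent_A s t \<beta> z
             else - laurent_B t \<gamma> (if i < n then inverse z else z))"
    by (simp add: e_def laurent_A_def laurent_B_def power_int_minus power_inverse)
  finally show ?thesis .
qed

end

section \<open>Fourier diagonalisation of the Laplacian\<close>

lemma sum_lessThan_add:
  fixes g :: "nat \<Rightarrow> 'a :: comm_monoid_add"
  shows "(\<Sum>c<n + m. g c) = (\<Sum>c<n. g c) + (\<Sum>c<m. g (n + c))"
  by (induction m) (auto simp: add_ac)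

lemma det_mat_diag: "det (mat_diag n f) = (\<Prod>i<n. f i :: 'a :: comm_ring_1)"
proof -
  have "det (mat_diag n f) = prod_list (diag_mat (mat_diag n f))"
    by (rule det_upper_triangular[of _ n]) (auto simp: mat_diag_def)
  then show ?thesis
    by (simp add: prod_list_diag_prod mat_diag_def atLeast0LessThan)
qed

lemma sum_root_of_unity_powers:
  fixes r :: complex
  assumes "r ^ n = 1" "r \<noteq> 1"
  shows "(\<Sum>c<n. r ^ c) = 0"
  using assms geometric_sum[of r n] by simp

text \<open>
  Two diagonal copies of the Fourier matrix: column \<open>c\<close> is the character of \<open>\<omega>\<^bsup>c mod n\<^esup>\<close>, supported
  on the block of \<open>c\<close>.
\<close>
definition fourier_mat :: "nat \<Rightarrow> complex \<Rightarrow> complex mat" where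
  "fourier_mat n \<omega> = mat (2 * n) (2 * n) (\<lambda>(k, c). of_bool ((k < n) = (c < n)) * (\<omega> ^ (c mod n)) ^ k)"

text \<open>
  By orthogonality of characters, the conjugate transpose is an inverse up to the factor \<open>n\<close>.
\<close>
lemma det_fourier_mat_nonzero:
  assumes \<omega>: "\<omega> ^ n = 1" and prim: "\<And>k. 0 < k \<Longrightarrow> k < n \<Longrightarrow> \<omega> ^ k \<noteq> 1" and n: "n > 0"
  shows "det (fourier_mat n \<omega>) \<noteq> 0"
proof -
  define U where "U = mat (2 * n) (2 * n) (\<lambda>(c, j). of_bool ((c < n) = (j < n)) * inverse ((\<omega> ^ (c mod n)) ^ j))"
  have \<omega>0: "\<omega> \<noteq> 0" using \<omega> n by (auto simp: power_0_left)
  have W: "fourier_mat n \<omega> \<in> carrier_mat (2 * n) (2 * n)" by (simp add: fourier_mat_def)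
  have U: "U \<in> carrier_mat (2 * n) (2 * n)" by (simp add: U_def)
  have orth: "(\<Sum>c<n. (\<omega> ^ c) ^ i * inverse ((\<omega> ^ c) ^ j)) = (if i = j then of_nat n else 0)"
    if ij: "i < 2 * n" "j < 2 * n" "(i < n) = (j < n)" for i j
  proof -
    let ?r = "\<omega> ^ i * inverse (\<omega> ^ j)"
    have "(\<Sum>c<n. (\<omega> ^ c) ^ i * inverse ((\<omega> ^ c) ^ j)) = (\<Sum>c<n. ?r ^ c)"
      by (simp add: power_mult_distrib power_inverse power_mult[symmetric] mult.commute)
    also have "\<dots> = (if i = j then of_nat n else 0)"
    proof (cases "i = j")
      case True
      then show ?thesis using \<omega>0 by simp
    next
      case False
      have "?r ^ n = (\<omega> ^ n) ^ i * inverse ((\<omega> ^ n) ^ j)"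
        by (simp add: power_mult_distrib power_inverse power_mult[symmetric] mult.commute)
      then have "?r ^ n = 1" using \<omega> by simp
      moreover have "?r \<noteq> 1"
      proof
        assume "?r = 1"
        then have eq: "\<omega> ^ i = \<omega> ^ j" using \<omega>0 by (simp add: field_simps)
        define a b where "a = min i j" and "b = max i j"
        have ab: "\<omega> ^ a = \<omega> ^ b" "a < b" "b - a < n" using eq False ij by (auto simp: a_def b_def min_def max_def)
        have "\<omega> ^ a * \<omega> ^ (b - a) = \<omega> ^ b" using ab(2) by (simp flip: power_add)
        then have "\<omega> ^ a * \<omega> ^ (b - a) = \<omega> ^ a * 1" using ab(1) by simp
        then have "\<omega> ^ (b - a) = 1" using \<omega>0 by (subst (asm) mult_cancel_left) simp
        then show False using prim[of "b - a"] ab by simp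
      qed
      ultimately show ?thesis using False sum_root_of_unity_powers by simp
    qed
    finally show ?thesis .
  qed
  have "fourier_mat n \<omega> * U = of_nat n \<cdot>\<^sub>m 1\<^sub>m (2 * n)"
  proof (rule eq_matI)
    fix i j assume "i < dim_row (of_nat n \<cdot>\<^sub>m 1\<^sub>m (2 * n) :: complex mat)" "j < dim_col (of_nat n \<cdot>\<^sub>m 1\<^sub>m (2 * n) :: complex mat)"
    then have ij: "i < 2 * n" "j < 2 * n" by auto
    let ?t = "\<lambda>c. (\<omega> ^ c) ^ i * inverse ((\<omega> ^ c) ^ j)"
    have "(fourier_mat n \<omega> * U) $$ (i, j) =
      (\<Sum>c<2 * n. of_bool ((i < n) = (c < n)) * (\<omega> ^ (c mod n)) ^ i *
         (of_bool ((c < n) = (j < n)) * inverse ((\<omega> ^ (c mod n)) ^ j)))"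
      using ij by (simp add: fourier_mat_def U_def scalar_prod_def atLeast0LessThan)
    also have "\<dots> = (\<Sum>c<n. of_bool (i < n) * of_bool (j < n) * ?t c) + (\<Sum>c<n. of_bool (\<not> i < n) * of_bool (\<not> j < n) * ?t c)"
      unfolding mult_2 sum_lessThan_add by (intro arg_cong2[of _ _ _ _ "(+)"] sum.cong) auto
    also have "\<dots> = of_bool ((i < n) = (j < n)) * (\<Sum>c<n. ?t c)"
      by (auto simp: sum_distrib_left[symmetric])
    also have "\<dots> = (of_nat n \<cdot>\<^sub>m 1\<^sub>m (2 * n)) $$ (i, j)"
      using ij orth[OF ij] by (cases "(i < n) = (j < n)") auto
    finally show "(fourier_mat n \<omega> * U) $$ (i, j) = (of_nat n \<cdot>\<^sub>m 1\<^sub>m (2 * n)) $$ (i, j)" .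
  qed (simp_all add: fourier_mat_def U_def)
  then have "det (fourier_mat n \<omega>) * det U = of_nat n ^ (2 * n)"
    using det_mult[OF W U] by simp
  then show ?thesis using n by auto
qed

text \<open>
  The hypothesis \<open>eigen\<close> says that conjugation by the Fourier matrix turns \<open>M\<close> into a matrix with four
  diagonal blocks. Diagonal matrices commute, so the determinant of the latter is that of the block-wise
  \<open>2 \<times> 2\<close> determinant.
\<close>
lemma det_block_circulant:
  fixes M :: "nat \<Rightarrow> nat \<Rightarrow> complex"
  assumes \<omega>: "\<omega> ^ n = 1" and prim: "\<And>k. 0 < k \<Longrightarrow> k < n \<Longrightarrow> \<omega> ^ k \<noteq> 1" and n: "n > 0"
    and eigen: "\<And>i c \<sigma>. i < 2 * n \<Longrightarrow> c < n \<Longrightarrow>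
      (\<Sum>k<2 * n. M i k * (of_bool ((k < n) = \<sigma>) * (\<omega> ^ c) ^ k)) = (\<omega> ^ c) ^ i * d (i < n) \<sigma> c"
  shows "det (mat (2 * n) (2 * n) (\<lambda>(i, j). M i j)) =
    (\<Prod>c<n. d True True c * d False False c - d True False c * d False True c)"
proof -
  let ?M = "mat (2 * n) (2 * n) (\<lambda>(i, j). M i j)" and ?W = "fourier_mat n \<omega>"
  define B where "B = four_block_mat (mat_diag n (d True True)) (mat_diag n (d True False))
    (mat_diag n (d False True)) (mat_diag n (d False False))"
  have W: "?W \<in> carrier_mat (2 * n) (2 * n)" by (simp add: fourier_mat_def)
  have B: "B \<in> carrier_mat (2 * n) (2 * n)"
    unfolding B_def mult_2 by (rule four_block_carrier_mat) auto
  have Bij: "B $$ (c', c) = (if c' mod n = c mod n then d (c' < n) (c < n) (c mod n) else 0)"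
    if "c' < 2 * n" "c < 2 * n" for c' c
    using that by (auto simp: B_def mat_diag_def four_block_mat_def Let_def le_mod_geq)
  have comm: "?M * ?W = ?W * B"
  proof (rule eq_matI)
    fix i c assume "i < dim_row (?W * B)" "c < dim_col (?W * B)"
    then have ic: "i < 2 * n" "c < 2 * n" using W B by auto
    have cn: "c mod n < n" using n by simp
    \<comment> \<open>The only column of the Fourier matrix that pairs with row \<open>i\<close> and column \<open>c\<close>.\<close>
    define c0 where "c0 = (if i < n then c mod n else n + c mod n)"
    have c0: "c0 < 2 * n" "c0 mod n = c mod n" "(c0 < n) = (i < n)" using cn by (auto simp: c0_def)
    have c0_uniq: "c' = c0" if "c' < 2 * n" "c' mod n = c mod n" "(i < n) = (c' < n)" for c'
      using that by (cases "c' < n") (auto simp: c0_def le_mod_geq not_less split: if_splits)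
    have "(?M * ?W) $$ (i, c) =
        (\<Sum>k<2 * n. M i k * (of_bool ((k < n) = (c < n)) * (\<omega> ^ (c mod n)) ^ k))"
      using ic by (simp add: fourier_mat_def scalar_prod_def atLeast0LessThan)
    also have "\<dots> = (\<omega> ^ (c mod n)) ^ i * d (i < n) (c < n) (c mod n)"
      using eigen[OF ic(1) cn] .
    also have "\<dots> = (\<Sum>c'<2 * n. if c' = c0 then (\<omega> ^ (c mod n)) ^ i * d (i < n) (c < n) (c mod n) else 0)"
      using c0(1) by simp
    also have "\<dots> = (\<Sum>c'<2 * n. ?W $$ (i, c') * B $$ (c', c))"
    proof (rule sum.cong[OF refl])
      fix c' assume c': "c' \<in> {..<2 * n}"
      show "(if c' = c0 then (\<omega> ^ (c mod n)) ^ i * d (i < n) (c < n) (c mod n) else 0) = ?W $$ (i, c') * B $$ (c', c)"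
      proof (cases "c' = c0")
        case True
        have "?W $$ (i, c0) = (\<omega> ^ (c mod n)) ^ i"
          using ic(1) c0 by (simp add: fourier_mat_def)
        moreover have "B $$ (c0, c) = d (i < n) (c < n) (c mod n)"
          using Bij[OF c0(1) ic(2)] c0(2,3) by simp
        ultimately show ?thesis using True by simp
      next
        case False
        then have "\<not> (c' mod n = c mod n \<and> (i < n) = (c' < n))" using c0_uniq[of c'] c' by blast
        then have "?W $$ (i, c') = 0 \<or> B $$ (c', c) = 0"
          using Bij[of c' c] ic c' by (auto simp: fourier_mat_def)
        then show ?thesis using False by auto
      qed
    qed
    also have "\<dots> = (?W * B) $$ (i, c)"
      using ic W B by (simp add: scalar_prod_def atLeast0LessThan)
    finally show "(?M * ?W) $$ (i, c) = (?W * B) $$ (i, c)" .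
  qed (use W B in auto)
  have "det ?M * det ?W = det (?M * ?W)" by (rule det_mult[OF _ W, symmetric]) simp
  also have "\<dots> = det ?W * det B" unfolding comm by (rule det_mult[OF W B])
  finally have "det ?W * det ?M = det ?W * det B" by (simp only: mult.commute)
  then have "det ?M = det B"
    using det_fourier_mat_nonzero[OF \<omega> prim n] by (simp only: mult_cancel_left) simp
  also have "det B = det (mat_diag n (d True True) * mat_diag n (d False False)
      - mat_diag n (d True False) * mat_diag n (d False True))"
    unfolding B_def by (rule det_four_block_mat[of _ n]) (simp_all add: mult.commute)
  also have "mat_diag n (d True True) * mat_diag n (d False False) - mat_diag n (d True False) * mat_diag n (d False True)
     = mat_diag n (\<lambda>c. d True True c * d False False c - d True False c * d False True c)"
    unfolding mat_diag_diag
  proof (rule eq_matI)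
    fix i j assume "i < dim_row (mat_diag n (\<lambda>c. d True True c * d False False c - d True False c * d False True c))"
      "j < dim_col (mat_diag n (\<lambda>c. d True True c * d False False c - d True False c * d False True c))"
    then have "i < n" "j < n" by (simp_all add: mat_diag_def)
    then show "(mat_diag n (\<lambda>c. d True True c * d False False c) - mat_diag n (\<lambda>c. d True False c * d False True c)) $$ (i, j)
        = mat_diag n (\<lambda>c. d True True c * d False False c - d True False c * d False True c) $$ (i, j)"
      by (simp add: mat_diag_def)
  qed (simp_all add: mat_diag_def)
  finally show ?thesis by (simp add: det_mat_diag)
qed

lemma laurent_A_inverse: "laurent_A s t \<beta> (inverse z) = laurent_A s t \<beta> z"
  by (simp add: laurent_A_def power_int_minus power_inverse add.commute)

text \<open>
  Both sides, doubled, are the limit of \<open>det (x I + L) / x\<close> at \<open>0\<close>: one by the matrix-tree theorem and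
  the other by diagonalisation, where the trivial character contributes \<open>(x + t)\<^sup>2 - t\<^sup>2 = x (x + 2 t)\<close>.
\<close>
theorem dih_tau_product:
  assumes \<beta>: "\<And>i. i \<in> {1..s} \<Longrightarrow> 0 < \<beta> i \<and> 2 * \<beta> i < n" and inj\<beta>: "inj_on \<beta> {1..s}"
    and \<gamma>: "\<And>i. i \<in> {1..t} \<Longrightarrow> \<gamma> i < n" and inj\<gamma>: "inj_on \<gamma> {1..t}" and n: "n > 0"
    and \<omega>: "\<omega> ^ n = 1" and prim: "\<And>k. 0 < k \<Longrightarrow> k < n \<Longrightarrow> \<omega> ^ k \<noteq> 1"
  shows "of_nat n * of_nat (dih_tau s t \<beta> \<gamma> n) = of_nat t * (\<Prod>c=1..<n. laurent_P s t \<beta> \<gamma> (\<omega> ^ c))"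
proof -
  let ?E = "dih_index_edges s t \<beta> \<gamma> n"
  let ?A = "laurent_A s t \<beta>" and ?B = "laurent_B t \<gamma>"
  let ?L = "\<lambda>x::complex. mat (2 * n) (2 * n) (\<lambda>(i, j). (if i = j then x + of_nat (card {k. k < 2 * n \<and> {i, k} \<in> ?E}) else 0)
              - of_bool ({i, j} \<in> ?E))"
  let ?R = "\<lambda>x. \<Prod>c=1..<n. (x + ?A (\<omega> ^ c)) * (x + ?A (\<omega> ^ c)) - ?B (\<omega> ^ c) * ?B (inverse (\<omega> ^ c))"
  have A1: "?A 1 = of_nat t" by (simp add: laurent_A_def)
  have B1: "?B 1 = - of_nat t" by (simp add: laurent_B_def)
  have det: "det (?L x) = x * (x + 2 * of_nat t) * ?R x" for x
  proof -
    define d where "d p q c = (if p = q then x + ?A (\<omega> ^ c) else ?B (if p then inverse (\<omega> ^ c) else \<omega> ^ c))" for p q :: bool and c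
    let ?M = "\<lambda>i j. (if i = j then x + of_nat (card {k. k < 2 * n \<and> {i, k} \<in> ?E}) else 0) - of_bool ({i, j} \<in> ?E)"
    have "det (?L x) = (\<Prod>c<n. d True True c * d False False c - d True False c * d False True c)"
    proof (rule det_block_circulant[OF \<omega> prim n])
      fix i c \<sigma> assume i: "i < 2 * n" and c: "c < n"
      let ?y = "\<lambda>k. of_bool ((k < n) = \<sigma>) * (\<omega> ^ c) ^ k"
      have z: "(\<omega> ^ c) ^ n = 1" using \<omega> by (metis power_mult mult.commute power_one)
      have "(\<Sum>k<2 * n. ?M i k * ?y k) = (\<Sum>k<2 * n. (if k = i then (x + of_nat (2 * s + t)) * ?y i else 0) - of_bool ({i, k} \<in> ?E) * ?y k)"
        using card_dih_neighbours[OF \<beta> inj\<beta> \<gamma> inj\<gamma> n i] by (intro sum.cong) (auto simp: left_diff_distrib)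
      also have "\<dots> = (x + of_nat (2 * s + t)) * ?y i - (\<Sum>k<2 * n. of_bool ({i, k} \<in> ?E) * ?y k)"
        using i by (simp add: sum_subtractf)
      also have "(\<Sum>k<2 * n. of_bool ({i, k} \<in> ?E) * ?y k) = (\<omega> ^ c) ^ i *
         (if (i < n) = \<sigma> then 2 * of_nat s + of_nat t - ?A (\<omega> ^ c) else - ?B (if i < n then inverse (\<omega> ^ c) else \<omega> ^ c))"
        by (rule dih_adjacency_on_characters[OF \<beta> inj\<beta> \<gamma> inj\<gamma> n z i])
      also have "(x + of_nat (2 * s + t)) * ?y i - (\<omega> ^ c) ^ i *
         (if (i < n) = \<sigma> then 2 * of_nat s + of_nat t - ?A (\<omega> ^ c) else - ?B (if i < n then inverse (\<omega> ^ c) else \<omega> ^ c))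
         = (\<omega> ^ c) ^ i * d (i < n) \<sigma> c"
        by (cases "(i < n) = \<sigma>") (simp_all add: d_def algebra_simps)
      finally show "(\<Sum>k<2 * n. ?M i k * ?y k) = (\<omega> ^ c) ^ i * d (i < n) \<sigma> c" .
    qed
    also have "\<dots> = (\<Prod>c<n. (x + ?A (\<omega> ^ c)) * (x + ?A (\<omega> ^ c)) - ?B (\<omega> ^ c) * ?B (inverse (\<omega> ^ c)))"
    proof (rule prod.cong[OF refl])
      fix c
      have swap: "d True False c * d False True c = ?B (\<omega> ^ c) * ?B (inverse (\<omega> ^ c))"
        unfolding d_def by (simp only: simp_thms if_True if_False) (rule mult.commute)
      show "d True True c * d False False c - d True False c * d False True c
          = (x + ?A (\<omega> ^ c)) * (x + ?A (\<omega> ^ c)) - ?B (\<omega> ^ c) * ?B (inverse (\<omega> ^ c))"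
        unfolding swap by (simp only: d_def simp_thms if_True)
    qed
    also have "{..<n} = insert 0 {1..<n}" using n by auto
    also have "(\<Prod>c\<in>insert 0 {1..<n}. (x + ?A (\<omega> ^ c)) * (x + ?A (\<omega> ^ c)) - ?B (\<omega> ^ c) * ?B (inverse (\<omega> ^ c)))
        = ((x + ?A (\<omega> ^ 0)) * (x + ?A (\<omega> ^ 0)) - ?B (\<omega> ^ 0) * ?B (inverse (\<omega> ^ 0))) * ?R x"
      by (rule prod.insert) simp_all
    also have "(x + ?A (\<omega> ^ 0)) * (x + ?A (\<omega> ^ 0)) - ?B (\<omega> ^ 0) * ?B (inverse (\<omega> ^ 0)) = x * (x + 2 * of_nat t)"
      by (simp add: A1 B1 algebra_simps)
    finally show ?thesis .
  qed
  have N: "2 * n > 0" using n by simp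
  have "((\<lambda>x. det (?L x) / x) \<longlongrightarrow> of_nat (2 * n * card (spanning_trees {..<2 * n} ?E))) (at 0)"
    by (rule matrix_tree_limit[where E = ?E and N = "2 * n", OF dih_index_edges_simple[OF \<beta> inj\<beta> \<gamma> inj\<gamma> n] N])
  moreover have "((\<lambda>x. det (?L x) / x) \<longlongrightarrow> (0 + 2 * of_nat t) * ?R 0) (at 0)"
  proof (rule Lim_transform_eventually)
    show "((\<lambda>x. (x + 2 * of_nat t) * ?R x) \<longlongrightarrow> (0 + 2 * of_nat t) * ?R 0) (at 0)"
      by (intro tendsto_intros)
    have cancel: "(x + 2 * of_nat t) * ?R x = det (?L x) / x" if "x \<noteq> 0" for x
      unfolding det using that by (simp only: mult.assoc nonzero_mult_div_cancel_left simp_thms)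
    show "\<forall>\<^sub>F x in at 0. (x + 2 * of_nat t) * ?R x = det (?L x) / x"
      by (rule eventually_mono[OF eventually_neq_at_within[of 0]]) (rule cancel)
  qed
  ultimately have "of_nat (2 * n * card (spanning_trees {..<2 * n} ?E)) = (0 + 2 * of_nat t) * ?R 0"
    by (rule tendsto_unique[rotated]) simp
  moreover have "?R 0 = (\<Prod>c=1..<n. laurent_P s t \<beta> \<gamma> (\<omega> ^ c))"
    by (simp add: laurent_P_def laurent_A_inverse)
  ultimately have "2 * (of_nat n * of_nat (dih_tau s t \<beta> \<gamma> n)) =
      2 * (of_nat t * (\<Prod>c=1..<n. laurent_P s t \<beta> \<gamma> (\<omega> ^ c)))"
    by (simp only: dih_tau_index[OF n] of_nat_mult of_nat_numeral add_0 mult.assoc)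
  then show ?thesis by (simp only: mult_cancel_left) simp
qed

section \<open>The Laurent polynomial on the unit circle\<close>

text \<open>
  This is the quotient of \<open>\<bar>1 - z\<^sup>m\<bar>\<^sup>2\<close> by \<open>\<bar>1 - z\<bar>\<^sup>2\<close>, extended continuously to \<open>z = 1\<close>, where its value is
  \<open>m\<^sup>2\<close>.
\<close>
definition dirichlet_sq :: "nat \<Rightarrow> complex \<Rightarrow> real" where
  "dirichlet_sq m z = (norm (\<Sum>l<m. z ^ l))\<^sup>2"

text \<open>
  The quotient of \<open>P\<close> by \<open>\<bar>1 - z\<bar>\<^sup>2\<close> on the unit circle, extended continuously to \<open>z = 1\<close> and written as a
  sum of nonnegative terms.
\<close>
definition circle_Q :: "nat \<Rightarrow> nat \<Rightarrow> (nat \<Rightarrow> nat) \<Rightarrow> (nat \<Rightarrow> nat) \<Rightarrow> complex \<Rightarrow> real" where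
  "circle_Q s t \<beta> \<gamma> z = 2 * real t * (\<Sum>i=1..s. dirichlet_sq (\<beta> i) z)
     + (norm (1 - z))\<^sup>2 * (\<Sum>i=1..s. dirichlet_sq (\<beta> i) z)\<^sup>2
     + (\<Sum>k=1..t. \<Sum>j=1..<k. dirichlet_sq (\<gamma> k - \<gamma> j) z)"

lemma dirichlet_sq_nonneg: "dirichlet_sq m z \<ge> 0"
  by (simp add: dirichlet_sq_def)

lemma norm_one_minus_power_sq:
  "(norm (1 - z ^ m))\<^sup>2 = (norm (1 - z))\<^sup>2 * dirichlet_sq m (z::complex)"
proof -
  have "1 - z ^ m = (1 - z) * (\<Sum>l<m. z ^ l)"
    by (rule one_diff_power_eq)
  then show ?thesis by (simp add: dirichlet_sq_def norm_mult power_mult_distrib)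
qed

lemma norm_diff_unit_sq:
  assumes "norm (u::complex) = 1" "norm v = 1"
  shows "(norm (u - v))\<^sup>2 = 2 - 2 * Re (u * cnj v)"
  using assms by (simp add: cmod_power2 norm_complex_def real_sqrt_eq_1_iff) (simp add: power2_eq_square algebra_simps)

text \<open>
  Expanding the square produces \<open>2 Re (u\<^sub>j cnj u\<^sub>k) = 2 - \<bar>u\<^sub>j - u\<^sub>k\<bar>\<^sup>2\<close> for every pair.
\<close>
lemma norm_sum_unit_sq:
  fixes u :: "nat \<Rightarrow> complex"
  assumes "\<And>j. norm (u j) = 1"
  shows "(norm (\<Sum>j=1..t. u j))\<^sup>2 = (real t)\<^sup>2 - (\<Sum>k=1..t. \<Sum>j=1..<k. (norm (u j - u k))\<^sup>2)"
proof (induction t)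
  case (Suc t)
  let ?S = "\<Sum>j=1..t. u j" and ?v = "u (Suc t)"
  have "(norm (?S + ?v))\<^sup>2 = (norm ?S)\<^sup>2 + (norm ?v)\<^sup>2 + 2 * Re (?S * cnj ?v)"
    unfolding cmod_power2 by (simp add: power2_eq_square algebra_simps)
  moreover have "Re (?S * cnj ?v) = (\<Sum>j=1..t. Re (u j * cnj ?v))"
    by (simp only: sum_distrib_right Re_sum)
  moreover have "(\<Sum>j=1..t. (norm (u j - ?v))\<^sup>2) = 2 * real t - 2 * (\<Sum>j=1..t. Re (u j * cnj ?v))"
    by (simp only: norm_diff_unit_sq[OF assms assms] sum_subtractf sum_distrib_left) simp
  moreover have "{1..<Suc t} = {1..t}" by auto
  ultimately show ?case using Suc assms[of "Suc t"]
    by (simp add: power2_eq_square algebra_simps)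
qed simp

text \<open>
  With \<open>w = \<bar>1 - z\<bar>\<^sup>2\<close> one has \<open>A = t + w U\<close> and \<open>\<bar>B\<bar>\<^sup>2 = t\<^sup>2 - w V\<close>, where \<open>U\<close> and \<open>V\<close> are the sums
  of \<open>dirichlet_sq\<close> over the \<open>\<beta>\<^sub>i\<close> and over the differences of the \<open>\<gamma>\<^sub>j\<close>; hence
  \<open>P = w (2 t U + w U\<^sup>2 + V)\<close>.
\<close>
lemma laurent_P_factor:
  assumes z: "norm z = 1" and \<gamma>: "strict_mono_on {1..t} \<gamma>"
  shows "laurent_P s t \<beta> \<gamma> z = of_real ((norm (1 - z))\<^sup>2 * circle_Q s t \<beta> \<gamma> z)"
proof -
  let ?U = "\<Sum>i=1..s. dirichlet_sq (\<beta> i) z"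
  let ?V = "\<Sum>k=1..t. \<Sum>j=1..<k. dirichlet_sq (\<gamma> k - \<gamma> j) z"
  let ?w = "(norm (1 - z))\<^sup>2"
  have inv: "inverse z = cnj z"
    using z complex_norm_square[of z] by (simp add: inverse_unique)
  have nz: "norm (z ^ m) = 1" for m using z by (simp add: norm_power)
  have pm: "2 - (z powi int m + z powi (- int m)) = of_real (?w * dirichlet_sq m z)" for m
  proof -
    have "z powi (- int m) = cnj (z ^ m)"
      by (simp add: power_int_minus inv[symmetric] power_inverse)
    then have "z powi int m + z powi (- int m) = of_real (2 * Re (z ^ m))"
      by (simp only: power_int_of_nat complex_add_cnj)
    moreover have "2 - 2 * Re (z ^ m) = ?w * dirichlet_sq m z"
      using norm_diff_unit_sq[of 1 "z ^ m"] nz[of m] norm_one_minus_power_sq[of z m]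
      by (simp del: complex_cnj_power)
    ultimately show ?thesis by (metis of_real_diff of_real_numeral)
  qed
  have "laurent_A s t \<beta> z = of_nat t + (\<Sum>i=1..s. 2 - (z powi int (\<beta> i) + z powi (- int (\<beta> i))))"
    unfolding laurent_A_def sum_subtractf by simp
  also have "\<dots> = of_real (real t + ?w * ?U)"
    unfolding pm by (simp add: sum_distrib_left)
  finally have A: "laurent_A s t \<beta> z = of_real (real t + ?w * ?U)" .
  have A': "laurent_A s t \<beta> (inverse z) = of_real (real t + ?w * ?U)"
    unfolding laurent_A_inverse by (rule A)
  have "laurent_B t \<gamma> (inverse z) = cnj (laurent_B t \<gamma> z)"
    by (simp add: laurent_B_def inv)
  then have "laurent_B t \<gamma> z * laurent_B t \<gamma> (inverse z) = of_real ((norm (laurent_B t \<gamma> z))\<^sup>2)"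
    by (simp only: complex_norm_square)
  then have B: "laurent_B t \<gamma> z * laurent_B t \<gamma> (inverse z) = of_real ((norm (\<Sum>j=1..t. z ^ \<gamma> j))\<^sup>2)"
    by (simp only: laurent_B_def norm_minus_cancel)
  have diff: "(norm (z ^ \<gamma> j - z ^ \<gamma> k))\<^sup>2 = ?w * dirichlet_sq (\<gamma> k - \<gamma> j) z"
    if "j < k" "j \<in> {1..t}" "k \<in> {1..t}" for j k
  proof -
    have "\<gamma> j < \<gamma> k" using \<gamma> that by (auto simp: strict_mono_on_def)
    then have "z ^ \<gamma> j - z ^ \<gamma> k = z ^ \<gamma> j * (1 - z ^ (\<gamma> k - \<gamma> j))"
      by (simp add: algebra_simps flip: power_add)
    then show ?thesis using nz[of "\<gamma> j"] by (simp add: norm_mult norm_one_minus_power_sq)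
  qed
  have "(norm (\<Sum>j=1..t. z ^ \<gamma> j))\<^sup>2 = (real t)\<^sup>2 - (\<Sum>k=1..t. \<Sum>j=1..<k. (norm (z ^ \<gamma> j - z ^ \<gamma> k))\<^sup>2)"
    using norm_sum_unit_sq[of "\<lambda>j. z ^ \<gamma> j" t] nz by blast
  also have "(\<Sum>k=1..t. \<Sum>j=1..<k. (norm (z ^ \<gamma> j - z ^ \<gamma> k))\<^sup>2) = ?w * ?V"
    unfolding sum_distrib_left by (intro sum.cong refl diff) auto
  finally have B2: "(norm (\<Sum>j=1..t. z ^ \<gamma> j))\<^sup>2 = (real t)\<^sup>2 - ?w * ?V" .
  have "laurent_P s t \<beta> \<gamma> z = of_real ((real t + ?w * ?U) * (real t + ?w * ?U) - ((real t)\<^sup>2 - ?w * ?V))"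
    unfolding laurent_P_def A A' B B2 by simp
  also have "(real t + ?w * ?U) * (real t + ?w * ?U) - ((real t)\<^sup>2 - ?w * ?V) = ?w * circle_Q s t \<beta> \<gamma> z"
    unfolding circle_Q_def by (simp add: power2_eq_square algebra_simps)
  finally show ?thesis .
qed

lemma circle_Q_one:
  assumes "strict_mono_on {1..t} \<gamma>"
  shows "circle_Q s t \<beta> \<gamma> 1 = dih_q s t \<beta> \<gamma>"
proof -
  have F1: "dirichlet_sq m 1 = (real m)\<^sup>2" for m by (simp add: dirichlet_sq_def)
  have "(real (\<gamma> k - \<gamma> j))\<^sup>2 = (real (\<gamma> j) - real (\<gamma> k))\<^sup>2" if "j < k" "j \<in> {1..t}" "k \<in> {1..t}" for j k
  proof -
    have "\<gamma> j < \<gamma> k" using assms that by (auto simp: strict_mono_on_def)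
    then show ?thesis by (simp add: of_nat_diff power2_commute)
  qed
  then have "(\<Sum>k=1..t. \<Sum>j=1..<k. (real (\<gamma> k - \<gamma> j))\<^sup>2) = (\<Sum>k=1..t. \<Sum>j=1..<k. (real (\<gamma> j) - real (\<gamma> k))\<^sup>2)"
    by (intro sum.cong refl) auto
  then show ?thesis by (simp add: circle_Q_def F1 dih_q_def)
qed

text \<open>
  The function \<open>b\<^sup>k \<mapsto> z\<^sup>k\<close>, \<open>a b\<^sup>k \<mapsto> c z\<^sup>-\<^sup>k\<close> is constant along edges, but it separates \<open>1\<close> from
  \<open>b\<close>.
\<close>
lemma dih_graph_disconnected_by_character:
  fixes z c :: complex
  assumes n: "n > 0" and zn: "z ^ n = 1" and z1: "z \<noteq> 1"
    and \<beta>: "\<And>i. i \<in> {1..s} \<Longrightarrow> z ^ \<beta> i = 1" and \<gamma>: "\<And>i. i \<in> {1..t} \<Longrightarrow> z ^ \<gamma> i = c"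
  shows "\<not> dih_graph_connected s t \<beta> \<gamma> n"
proof
  assume conn: "dih_graph_connected s t \<beta> \<gamma> n"
  define \<psi> where "\<psi> = (\<lambda>(e, k). if e then c * z powi (- k) else z powi k)"
  have z0: "z \<noteq> 0" using zn n by (auto simp: power_0_left)
  have mul: "\<psi> (g \<otimes>\<^bsub>dihedral n\<^esub> x) = \<psi> g" if "x \<in> dih_conn_set s t \<beta> \<gamma> n" for g x
  proof -
    obtain e k where g: "g = (e, k)" by (cases g)
    have neg: "z powi (- (m mod int n)) = z powi (- m)" for m
      using power_int_mod_root_of_unity[OF zn, of m] by (simp add: power_int_minus)
    have rot: "\<psi> (g \<otimes>\<^bsub>dihedral n\<^esub> (False, l mod int n)) = \<psi> g" if "z powi l = 1" for l
      using that z0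
      by (simp add: g dihedral_def \<psi>_def mod_simps power_int_mod_root_of_unity[OF zn] neg power_int_add power_int_diff power_int_minus)
    have ref: "\<psi> (g \<otimes>\<^bsub>dihedral n\<^esub> (True, l mod int n)) = \<psi> g" if "z powi l = c" for l
      using that z0
      by (auto simp: g dihedral_def \<psi>_def mod_simps power_int_mod_root_of_unity[OF zn] neg power_int_add power_int_diff power_int_minus field_simps)
    show ?thesis
      using \<open>x \<in> _\<close> \<beta> \<gamma> unfolding dih_conn_set_eq[OF n]
      by (auto intro!: rot ref simp: power_int_minus)
  qed
  have edge: "\<psi> g = \<psi> h" if "{g, h} \<in> dih_graph_edges s t \<beta> \<gamma> n" for g h
    using that mul unfolding dih_graph_edges_def cayley_edges_def
    by (auto simp: doubleton_eq_iff)
  have "n \<noteq> 1" using zn z1 by auto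
  then have "(False, 0) \<in> carrier (dihedral n)" "(False, 1) \<in> carrier (dihedral n)"
    using n by (auto simp: dihedral_def)
  then have "((False, 0), (False, 1)) \<in> {(x, y). x \<in> carrier (dihedral n) \<and> y \<in> carrier (dihedral n) \<and> {x, y} \<in> dih_graph_edges s t \<beta> \<gamma> n}\<^sup>*"
    using conn unfolding dih_graph_connected_def graph_connected_def by blast
  then have "\<psi> (False, 0) = \<psi> (False, 1)"
  proof (induction rule: rtrancl_induct)
    case (step y w)
    then show ?case using edge by auto
  qed simp
  then show False using z1 by (simp add: \<psi>_def)
qed

text \<open>
  If \<open>Q(z) = 0\<close>, all its terms vanish, so \<open>z\<^bsup>\<beta>\<^esup> = 1\<close> and all \<open>z\<^bsup>\<gamma>\<^esup>\<close> agree. Unless \<open>s = 0\<close> and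
  \<open>t = 1\<close>, when the graph is a perfect matching and disconnected for \<open>n \<ge> 2\<close>, this excludes \<open>z = 1\<close> and
  makes \<open>z\<close> a root of unity, and then the graph is disconnected whenever \<open>n\<close> is a multiple of the order of \<open>z\<close>.
\<close>
lemma circle_Q_pos:
  assumes t: "t \<ge> 1" and \<beta>: "\<And>i. i \<in> {1..s} \<Longrightarrow> \<beta> i > 0" and \<gamma>: "strict_mono_on {1..t} \<gamma>"
    and conn: "\<forall>\<^sub>F n in sequentially. dih_graph_connected s t \<beta> \<gamma> n"
    and z: "norm z = 1"
  shows "circle_Q s t \<beta> \<gamma> z > 0"
proof (rule ccontr)
  assume "\<not> circle_Q s t \<beta> \<gamma> z > 0"
  obtain N where N: "\<And>n. n \<ge> N \<Longrightarrow> dih_graph_connected s t \<beta> \<gamma> n"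
    using conn by (auto simp: eventually_sequentially)
  have st: "s \<ge> 1 \<or> t \<ge> 2"
  proof (rule ccontr)
    assume "\<not> (s \<ge> 1 \<or> t \<ge> 2)"
    \<comment> \<open>With one reflection as only generator the graph is a perfect matching; any nontrivial \<open>n\<close>-th
        root of unity satisfies the hypotheses of the character argument.\<close>
    then have s0: "s = 0" and t1: "t = 1" using t by auto
    define n where "n = N + 2"
    define \<omega> where "\<omega> = cis (2 * pi / real n)"
    have n2: "n \<ge> 2" "n \<ge> N" by (auto simp: n_def)
    have "\<omega> ^ n = cis (real n * (2 * pi / real n))" by (simp only: \<omega>_def Complex.DeMoivre)
    also have "\<dots> = 1" using n2 by simp
    finally have "\<omega> ^ n = 1" .
    moreover have "\<omega> \<noteq> 1"
    proof
      assume "\<omega> = 1"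
      then have "cos (2 * pi / real n) = 1" by (simp add: \<omega>_def cis.code complex_eq_iff)
      moreover have "cos (2 * pi / real n) < cos 0"
        using n2 by (intro cos_monotone_0_pi) (auto simp: field_simps)
      ultimately show False by simp
    qed
    ultimately have "\<not> dih_graph_connected s t \<beta> \<gamma> n"
      using n2 s0 t1 by (intro dih_graph_disconnected_by_character[where z = \<omega> and c = "\<omega> ^ \<gamma> 1"]) auto
    then show False using N n2 by blast
  qed
  let ?U = "\<Sum>i=1..s. dirichlet_sq (\<beta> i) z"
  let ?V = "\<Sum>k=1..t. \<Sum>j=1..<k. dirichlet_sq (\<gamma> k - \<gamma> j) z"
  have U0: "?U \<ge> 0" and V0: "?V \<ge> 0" by (auto intro!: sum_nonneg dirichlet_sq_nonneg)
  have "2 * real t * ?U + (norm (1 - z))\<^sup>2 * ?U\<^sup>2 + ?V \<le> 0"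
    using \<open>\<not> circle_Q s t \<beta> \<gamma> z > 0\<close> by (simp add: circle_Q_def)
  moreover have "2 * real t * ?U \<ge> ?U" using t U0 by (simp add: mult_le_cancel_right1)
  moreover have "(norm (1 - z))\<^sup>2 * ?U\<^sup>2 \<ge> 0" by simp
  ultimately have UV: "?U = 0" "?V = 0" using U0 V0 by linarith+
  have D\<beta>: "dirichlet_sq (\<beta> i) z = 0" if "i \<in> {1..s}" for i
    using UV(1) that by (simp add: sum_nonneg_eq_0_iff dirichlet_sq_nonneg)
  have D\<gamma>: "dirichlet_sq (\<gamma> k - \<gamma> j) z = 0" if "j \<in> {1..t}" "k \<in> {1..t}" "j < k" for j k
    using UV(2) that by (simp add: sum_nonneg_eq_0_iff dirichlet_sq_nonneg sum_nonneg)
  have pow1: "z ^ m = 1" if "dirichlet_sq m z = 0" for m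
    using norm_one_minus_power_sq[of z m] that by simp
  have z1: "z \<noteq> 1"
  proof
    assume "z = 1"
    then have D1: "dirichlet_sq m z = (real m)\<^sup>2" for m by (simp add: dirichlet_sq_def)
    show False
    proof (cases "s \<ge> 1")
      case True
      then show ?thesis using D\<beta>[of 1] \<beta>[of 1] D1 by simp
    next
      case False
      then have "t \<ge> 2" using st by simp
      then have "\<gamma> 1 < \<gamma> 2" using \<gamma> by (auto simp: strict_mono_on_def)
      then show ?thesis using D\<gamma>[of 1 2] \<open>t \<ge> 2\<close> D1 by simp
    qed
  qed
  have z\<beta>: "z ^ \<beta> i = 1" if "i \<in> {1..s}" for i using pow1 D\<beta> that by blast
  have z\<gamma>: "z ^ \<gamma> i = z ^ \<gamma> 1" if "i \<in> {1..t}" for i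
  proof (cases "i = 1")
    case False
    then have i: "1 < i" "1 \<in> {1..t}" using that by auto
    then have "\<gamma> 1 < \<gamma> i" using \<gamma> that by (auto simp: strict_mono_on_def)
    then have "z ^ \<gamma> i = z ^ \<gamma> 1 * z ^ (\<gamma> i - \<gamma> 1)" by (simp flip: power_add)
    then show ?thesis using pow1[OF D\<gamma>[OF i(2) that i(1)]] by simp
  qed simp
  have "\<exists>m>0. z ^ m = 1"
  proof (cases "s \<ge> 1")
    case True
    then show ?thesis using z\<beta>[of 1] \<beta>[of 1] by auto
  next
    case False
    then have t2: "t \<ge> 2" using st by simp
    then have "\<gamma> 1 < \<gamma> 2" using \<gamma> by (auto simp: strict_mono_on_def)
    then show ?thesis using pow1[OF D\<gamma>[of 1 2]] t2 by (intro exI[of _ "\<gamma> 2 - \<gamma> 1"]) auto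
  qed
  then obtain m where m: "m > 0" "z ^ m = 1" by blast
  \<comment> \<open>A multiple of \<open>m\<close> that is large enough for the graph to be connected.\<close>
  define n where "n = m * (N + 1)"
  have "n \<ge> 1 * (N + 1)" unfolding n_def using m by (intro mult_right_mono) auto
  then have n: "n > 0" "n \<ge> N" by auto
  have "z ^ n = 1" unfolding n_def power_mult m(2) by simp
  then have "\<not> dih_graph_connected s t \<beta> \<gamma> n"
    by (rule dih_graph_disconnected_by_character[OF n(1) _ z1 z\<beta> z\<gamma>])
  then show False using N n by blast
qed

text \<open>
  This is the factorisation \<open>\<Prod> (x - \<omega>\<^sup>c) = 1 + x + \<dots> + x\<^bsup>n - 1\<^esup>\<close>, taken over the nontrivial roots
  of unity, at \<open>x = 1\<close>. Both sides are obtained for \<open>x \<noteq> 1\<close> by dividing \<open>x\<^sup>n - 1\<close> by \<open>x - 1\<close>.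
\<close>
lemma prod_roots_of_unity_minus:
  fixes \<omega> :: complex
  assumes \<omega>: "\<omega> ^ n = 1" and prim: "\<And>k. 0 < k \<Longrightarrow> k < n \<Longrightarrow> \<omega> ^ k \<noteq> 1" and n: "n > 0"
  shows "(\<Prod>c=1..<n. 1 - \<omega> ^ c) = of_nat n"
proof -
  have \<omega>0: "\<omega> \<noteq> 0" using \<omega> n by (auto simp: power_0_left)
  have inj: "inj_on (\<lambda>c. \<omega> ^ c) {..<n}"
  proof (rule linorder_inj_onI)
    fix a b assume ab: "a < b" "a \<in> {..<n}" "b \<in> {..<n}"
    have "\<omega> ^ a * \<omega> ^ (b - a) = \<omega> ^ b" using ab(1) by (simp flip: power_add)
    moreover have "\<omega> ^ (b - a) \<noteq> 1" using prim[of "b - a"] ab by simp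
    ultimately show "\<omega> ^ a \<noteq> \<omega> ^ b" using \<omega>0 by (metis mult_cancel_left1 power_eq_0_iff)
  qed auto
  have roots: "{z. z ^ n = 1} = (\<lambda>c. \<omega> ^ c) ` {..<n}"
  proof (rule card_subset_eq[symmetric])
    show "finite {z::complex. z ^ n = 1}" using n by (intro finite_roots_unity) simp
    show "(\<lambda>c. \<omega> ^ c) ` {..<n} \<subseteq> {z. z ^ n = 1}"
    proof
      fix y assume "y \<in> (\<lambda>c. \<omega> ^ c) ` {..<n}"
      then obtain c where "y = \<omega> ^ c" by blast
      then have "y ^ n = (\<omega> ^ n) ^ c" by (simp add: power_mult[symmetric] mult.commute)
      then show "y \<in> {z. z ^ n = 1}" using \<omega> by simp
    qed
    show "card ((\<lambda>c. \<omega> ^ c) ` {..<n}) = card {z::complex. z ^ n = 1}"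
      using inj n by (simp add: card_image card_roots_unity_eq)
  qed
  have fact: "x ^ n - 1 = (\<Prod>c<n. x - \<omega> ^ c)" for x
  proof -
    define p :: "complex poly" where "p = Polynomial.monom 1 n - 1"
    have pz: "poly p z = z ^ n - 1" for z by (simp add: p_def poly_monom)
    have deg: "degree p = n"
      unfolding p_def diff_conv_add_uminus using n
      by (subst degree_add_eq_left) (auto simp: degree_monom_eq)
    have lc: "lead_coeff p = 1" unfolding deg using n by (simp add: p_def)
    have "rsquarefree p"
      unfolding rsquarefree_roots
    proof (intro allI notI)
      fix a assume "poly p a = 0 \<and> poly (pderiv p) a = 0"
      then have "a ^ n = 1" "of_nat n * a ^ (n - 1) = 0"
        by (auto simp: pz p_def pderiv_diff pderiv_monom poly_monom)
      then show False using n by (auto simp: power_0_left)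
    qed
    then have "Polynomial.smult (lead_coeff p) (\<Prod>z|poly p z = 0. [:-z, 1:]) = p"
      by (rule complex_poly_decompose_rsquarefree)
    then have "p = (\<Prod>z\<in>(\<lambda>c. \<omega> ^ c) ` {..<n}. [:-z, 1:])"
      by (simp add: lc pz roots[symmetric])
    then have "poly p x = (\<Prod>z\<in>(\<lambda>c. \<omega> ^ c) ` {..<n}. x - z)"
      by (simp only: poly_prod) simp
    also have "\<dots> = (\<Prod>c<n. x - \<omega> ^ c)" by (simp add: prod.reindex[OF inj])
    finally show ?thesis by (simp only: pz)
  qed
  have split: "(\<Prod>c=1..<n. x - \<omega> ^ c) = (\<Sum>j<n. x ^ j)" if "x \<noteq> 1" for x
  proof -
    have "{..<n} = insert 0 {1..<n}" using n by auto
    then have "(x - 1) * (\<Prod>c=1..<n. x - \<omega> ^ c) = x ^ n - 1"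
      by (simp add: fact)
    also have "\<dots> = (x - 1) * (\<Sum>j<n. x ^ j)" by (rule power_diff_1_eq)
    finally show ?thesis using that by simp
  qed
  have "((\<lambda>x. \<Sum>j<n. x ^ j) \<longlongrightarrow> (\<Sum>j<n. 1 ^ j)) (at (1::complex))"
    by (intro tendsto_intros)
  then have "((\<lambda>x. \<Prod>c=1..<n. x - \<omega> ^ c) \<longlongrightarrow> (\<Sum>j<n. 1 ^ j)) (at 1)"
    by (rule Lim_transform_eventually)
       (rule eventually_mono[OF eventually_neq_at_within[of 1]], rule split[symmetric])
  moreover have "((\<lambda>x. \<Prod>c=1..<n. x - \<omega> ^ c) \<longlongrightarrow> (\<Prod>c=1..<n. 1 - \<omega> ^ c)) (at 1)"
    by (intro tendsto_intros)
  ultimately have "(\<Prod>c=1..<n. 1 - \<omega> ^ c) = (\<Sum>j<n. 1 ^ j)"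
    by (intro tendsto_unique[of "at (1::complex)"]) auto
  then show ?thesis by simp
qed

section \<open>Riemann sums of smooth periodic functions\<close>

definition twice_cont_diff :: "(real \<Rightarrow> real) \<Rightarrow> bool" where
  "twice_cont_diff f \<longleftrightarrow> (\<exists>f' f''. (\<forall>x. (f has_real_derivative f' x) (at x)) \<and>
     (\<forall>x. (f' has_real_derivative f'' x) (at x)) \<and> continuous_on UNIV f'')"

lemma twice_cont_diffI:
  assumes "\<And>x. (f has_real_derivative f' x) (at x)" "\<And>x. (f' has_real_derivative f'' x) (at x)"
    "continuous_on UNIV f''"
  shows "twice_cont_diff f"
  unfolding twice_cont_diff_def
  by (rule exI[of _ f'], rule exI[of _ f'']) (simp add: assms)

lemma twice_cont_diffE:
  assumes "twice_cont_diff f"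
  obtains f' f'' where "\<And>x. (f has_real_derivative f' x) (at x)" "\<And>x. (f' has_real_derivative f'' x) (at x)"
    "continuous_on UNIV f''" "continuous_on UNIV f'" "continuous_on UNIV f"
proof -
  from assms obtain f' f'' where d: "\<And>x. (f has_real_derivative f' x) (at x)" "\<And>x. (f' has_real_derivative f'' x) (at x)"
    "continuous_on UNIV f''" unfolding twice_cont_diff_def by blast
  have "continuous_on UNIV f'" "continuous_on UNIV f"
    using d(1,2) by (auto intro: DERIV_continuous_on has_field_derivative_at_within)
  then show ?thesis by (rule that[OF d])
qed

lemma twice_cont_diff_const: "twice_cont_diff (\<lambda>_. c)"
  by (rule twice_cont_diffI[where f' = "\<lambda>_. 0" and f'' = "\<lambda>_. 0"]) auto

lemma twice_cont_diff_cos: "twice_cont_diff (\<lambda>x. cos (c * x))"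
  by (rule twice_cont_diffI[where f' = "\<lambda>x. - sin (c * x) * c" and f'' = "\<lambda>x. - cos (c * x) * c * c"])
     (auto intro!: derivative_eq_intros continuous_intros)

lemma twice_cont_diff_sin: "twice_cont_diff (\<lambda>x. sin (c * x))"
  by (rule twice_cont_diffI[where f' = "\<lambda>x. cos (c * x) * c" and f'' = "\<lambda>x. - sin (c * x) * c * c"])
     (auto intro!: derivative_eq_intros continuous_intros)

lemma twice_cont_diff_add:
  assumes "twice_cont_diff f" "twice_cont_diff g"
  shows "twice_cont_diff (\<lambda>x. f x + g x)"
proof -
  obtain f' f'' where f: "\<And>x. (f has_real_derivative f' x) (at x)" "\<And>x. (f' has_real_derivative f'' x) (at x)"
    "continuous_on UNIV f''" using assms(1) by (rule twice_cont_diffE) blast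
  obtain g' g'' where g: "\<And>x. (g has_real_derivative g' x) (at x)" "\<And>x. (g' has_real_derivative g'' x) (at x)"
    "continuous_on UNIV g''" using assms(2) by (rule twice_cont_diffE) blast
  show ?thesis
    by (rule twice_cont_diffI[where f' = "\<lambda>x. f' x + g' x" and f'' = "\<lambda>x. f'' x + g'' x"])
       (use f g in \<open>auto intro!: derivative_intros continuous_intros\<close>)
qed

lemma twice_cont_diff_mult:
  assumes "twice_cont_diff f" "twice_cont_diff g"
  shows "twice_cont_diff (\<lambda>x. f x * g x)"
proof -
  obtain f' f'' where f: "\<And>x. (f has_real_derivative f' x) (at x)" "\<And>x. (f' has_real_derivative f'' x) (at x)"
    "continuous_on UNIV f''" "continuous_on UNIV f'" "continuous_on UNIV f"
    using assms(1) by (rule twice_cont_diffE) blast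
  obtain g' g'' where g: "\<And>x. (g has_real_derivative g' x) (at x)" "\<And>x. (g' has_real_derivative g'' x) (at x)"
    "continuous_on UNIV g''" "continuous_on UNIV g'" "continuous_on UNIV g"
    using assms(2) by (rule twice_cont_diffE) blast
  show ?thesis
  proof (rule twice_cont_diffI)
    show "((\<lambda>x. f x * g x) has_real_derivative f' x * g x + g' x * f x) (at x)" for x
      by (rule DERIV_mult[OF f(1) g(1)])
    show "((\<lambda>x. f' x * g x + g' x * f x) has_real_derivative
        (f'' x * g x + g' x * f' x) + (g'' x * f x + f' x * g' x)) (at x)" for x
      by (intro DERIV_add DERIV_mult f g)
    show "continuous_on UNIV (\<lambda>x. (f'' x * g x + g' x * f' x) + (g'' x * f x + f' x * g' x))"
      using f(3-5) g(3-5) by (intro continuous_intros)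
  qed
qed

lemma twice_cont_diff_sum:
  assumes "\<And>i. i \<in> A \<Longrightarrow> twice_cont_diff (f i)"
  shows "twice_cont_diff (\<lambda>x. \<Sum>i\<in>A. f i x)"
  using assms
  by (induction A rule: infinite_finite_induct) (auto intro: twice_cont_diff_const twice_cont_diff_add)

lemma twice_cont_diff_ln:
  assumes "twice_cont_diff f" "\<And>x. f x > 0"
  shows "twice_cont_diff (\<lambda>x. ln (f x))"
proof -
  obtain f' f'' where f: "\<And>x. (f has_real_derivative f' x) (at x)" "\<And>x. (f' has_real_derivative f'' x) (at x)"
    "continuous_on UNIV f''" "continuous_on UNIV f'" "continuous_on UNIV f"
    using assms(1) by (rule twice_cont_diffE) blast
  have nz: "f x \<noteq> 0" for x using assms(2)[of x] by simp
  show ?thesis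
  proof (rule twice_cont_diffI)
    show "((\<lambda>x. ln (f x)) has_real_derivative f' x / f x) (at x)" for x
      using assms(2)[of x] by (auto intro!: derivative_eq_intros f)
    show "((\<lambda>x. f' x / f x) has_real_derivative (f'' x * f x - f' x * f' x) / (f x * f x)) (at x)" for x
      by (rule DERIV_divide[OF f(2) f(1) nz])
    show "continuous_on UNIV (\<lambda>x. (f'' x * f x - f' x * f' x) / (f x * f x))"
      using f(3-5) nz by (intro continuous_intros) auto
  qed
qed

text \<open>
  The increment of \<open>F\<close> and its trapezoidal approximation are compared through their difference \<open>G\<close>, whose
  derivative is half a first-order Taylor remainder of \<open>f\<close>; the mean value theorem is applied to
  \<open>G\<close>, \<open>f\<close> and \<open>f'\<close> in turn.
\<close>
lemma trapezoid_interval: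
  fixes f :: "real \<Rightarrow> real"
  assumes ab: "a < b"
    and F: "\<And>x. x \<in> {a..b} \<Longrightarrow> (F has_real_derivative f x) (at x)"
    and f: "\<And>x. x \<in> {a..b} \<Longrightarrow> (f has_real_derivative f' x) (at x)"
    and f': "\<And>x. x \<in> {a..b} \<Longrightarrow> (f' has_real_derivative f'' x) (at x)"
    and K: "\<And>x. x \<in> {a..b} \<Longrightarrow> \<bar>f'' x\<bar> \<le> K"
  shows "\<bar>F b - F a - (b - a) * (f a + f b) / 2\<bar> \<le> K * (b - a) ^ 3"
proof -
  have K0: "K \<ge> 0" using K[of a] ab by auto
  define G where "G x = F x - F a - (x - a) * (f a + f x) / 2" for x
  have G': "(G has_real_derivative (f x - f a - (x - a) * f' x) / 2) (at x)" if "x \<in> {a..b}" for x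
    unfolding G_def using F[OF that] f[OF that] by (auto intro!: derivative_eq_intros simp: field_simps)
  obtain \<xi> where \<xi>: "a < \<xi>" "\<xi> < b" "G b - G a = (b - a) * ((f \<xi> - f a - (\<xi> - a) * f' \<xi>) / 2)"
    using MVT2[OF ab, of G "\<lambda>x. (f x - f a - (x - a) * f' x) / 2"] G' by auto
  obtain \<eta> where \<eta>: "a < \<eta>" "\<eta> < \<xi>" "f \<xi> - f a = (\<xi> - a) * f' \<eta>"
    using MVT2[OF \<xi>(1), of f f'] f \<xi>(1,2) by auto
  obtain \<zeta> where \<zeta>: "\<eta> < \<zeta>" "\<zeta> < \<xi>" "f' \<xi> - f' \<eta> = (\<xi> - \<eta>) * f'' \<zeta>"
    using MVT2[OF \<eta>(2), of f' f''] f' \<xi>(1,2) \<eta>(1,2) by auto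
  have "f \<xi> - f a - (\<xi> - a) * f' \<xi> = - (\<xi> - a) * ((\<xi> - \<eta>) * f'' \<zeta>)"
    unfolding \<eta>(3) \<zeta>(3)[symmetric] by (simp add: algebra_simps)
  then have "\<bar>G b - G a\<bar> = (b - a) * ((\<xi> - a) * ((\<xi> - \<eta>) * \<bar>f'' \<zeta>\<bar>)) / 2"
    unfolding \<xi>(3) using ab \<xi> \<eta> by (simp add: abs_mult)
  also have "\<dots> \<le> (b - a) * ((b - a) * ((b - a) * K))"
  proof -
    have "(\<xi> - \<eta>) * \<bar>f'' \<zeta>\<bar> \<le> (b - a) * K"
      using \<xi> \<eta> \<zeta> K[of \<zeta>] K0 by (intro mult_mono) auto
    then have "(\<xi> - a) * ((\<xi> - \<eta>) * \<bar>f'' \<zeta>\<bar>) \<le> (b - a) * ((b - a) * K)"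
      using \<xi> \<eta> by (intro mult_mono[of "\<xi> - a"]) auto
    then have "(b - a) * ((\<xi> - a) * ((\<xi> - \<eta>) * \<bar>f'' \<zeta>\<bar>)) \<le> (b - a) * ((b - a) * ((b - a) * K))"
      using ab by (intro mult_left_mono) auto
    moreover have "0 \<le> (b - a) * ((\<xi> - a) * ((\<xi> - \<eta>) * \<bar>f'' \<zeta>\<bar>))"
      using ab \<xi> \<eta> by simp
    ultimately show ?thesis by linarith
  qed
  finally show ?thesis by (simp add: G_def power3_eq_cube algebra_simps)
qed

text \<open>
  Because \<open>f 0 = f 1\<close>, the left Riemann sum coincides with the trapezoidal rule, whose error on each
  of the \<open>n\<close> intervals is \<open>O(1/n\<^sup>3)\<close>. After scaling by \<open>n\<close> the total error is \<open>O(1/n)\<close>.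
\<close>
theorem periodic_riemann_sum:
  assumes C2: "twice_cont_diff f" and per: "f 0 = f 1"
  shows "(\<lambda>n. (\<Sum>k<n. f (real k / real n)) - real n * integral {0..1} f) \<longlonglongrightarrow> 0"
proof -
  obtain f' f'' where f: "\<And>x. (f has_real_derivative f' x) (at x)" "\<And>x. (f' has_real_derivative f'' x) (at x)"
    "continuous_on UNIV f''" "continuous_on UNIV f'" "continuous_on UNIV f"
    using C2 by (rule twice_cont_diffE) blast
  have "compact (f'' ` {0..1})"
    using f(3) by (intro compact_continuous_image) (auto intro: continuous_on_subset)
  then obtain K where K: "\<And>x. x \<in> {0..1} \<Longrightarrow> \<bar>f'' x\<bar> \<le> K"
    using compact_imp_bounded bounded_iff by (metis image_eqI real_norm_def)
  \<comment> \<open>The larger interval \<open>[-1, 2]\<close> makes the derivative two-sided at the end points \<open>0\<close> and \<open>1\<close>.\<close>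
  obtain F where F': "\<And>x. x \<in> {-1..2} \<Longrightarrow> (F has_vector_derivative f x) (at x within {-1..2})"
    using antiderivative_continuous[of "-1" 2 f] f(5) continuous_on_subset by blast
  have F: "(F has_real_derivative f x) (at x)" if "x \<in> {0..1}" for x
  proof -
    have "x \<in> interior {-1..2}" using that by simp
    then have "at x within {-1..2} = at x" by (rule at_within_interior)
    then show ?thesis using F'[of x] that
      by (simp add: has_real_derivative_iff_has_vector_derivative)
  qed
  have "(f has_integral F 1 - F 0) {0..1}"
  proof (rule fundamental_theorem_of_calculus)
    fix x :: real assume "x \<in> {0..1}"
    then show "(F has_vector_derivative f x) (at x within {0..1})"
      using F by (simp only: has_real_derivative_iff_has_vector_derivative has_vector_derivative_at_within)
  qed simp
  then have int: "integral {0..1} f = F 1 - F 0" by (rule integral_unique)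
  have bound: "\<bar>(\<Sum>k<n. f (real k / real n)) - real n * integral {0..1} f\<bar> \<le> K / real n" if n: "n > 0" for n
  proof -
    let ?x = "\<lambda>k. real k / real n"
    let ?e = "\<lambda>k. F (?x (Suc k)) - F (?x k) - (?x (Suc k) - ?x k) * (f (?x k) + f (?x (Suc k))) / 2"
    have h: "?x (Suc k) - ?x k = 1 / real n" for k
      using n by (simp add: field_simps)
    have e: "\<bar>?e k\<bar> \<le> K / real n ^ 3" if "k < n" for k
    proof -
      have sub: "x \<in> {0..1}" if "x \<in> {?x k..?x (Suc k)}" for x
      proof -
        have "0 \<le> ?x k" "?x (Suc k) \<le> 1" using n \<open>k < n\<close> by auto
        then show ?thesis using that unfolding atLeastAtMost_iff by linarith
      qed
      have "\<bar>?e k\<bar> \<le> K * (?x (Suc k) - ?x k) ^ 3"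
        by (rule trapezoid_interval[where f' = f' and f'' = f''])
           (use n sub F f(1,2) K in \<open>auto simp: divide_strict_right_mono\<close>)
      then show ?thesis unfolding h by (simp add: power_divide)
    qed
    have "(\<Sum>k<n. f (?x k) + f (?x (Suc k))) = 2 * (\<Sum>k<n. f (?x k))"
    proof -
      have "(\<Sum>k<n. f (?x (Suc k)) - f (?x k)) = f (?x n) - f (?x 0)"
        by (rule sum_lessThan_telescope)
      also have "\<dots> = 0" using n per by simp
      finally show ?thesis by (simp add: sum_subtractf sum.distrib)
    qed
    then have "(\<Sum>k<n. (?x (Suc k) - ?x k) * (f (?x k) + f (?x (Suc k))) / 2) = (\<Sum>k<n. f (?x k)) / real n"
      unfolding h by (simp add: sum_divide_distrib[symmetric])
    moreover have "(\<Sum>k<n. F (?x (Suc k)) - F (?x k)) = F 1 - F 0"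
      using sum_lessThan_telescope[of "\<lambda>k. F (?x k)" n] n by simp
    ultimately have "(\<Sum>k<n. ?e k) = integral {0..1} f - (\<Sum>k<n. f (?x k)) / real n"
      unfolding sum_subtractf[of "\<lambda>k. F (?x (Suc k)) - F (?x k)"] int by simp
    then have "(\<Sum>k<n. f (?x k)) - real n * integral {0..1} f = - (real n * (\<Sum>k<n. ?e k))"
      using n by (simp only:) (simp add: algebra_simps)
    then have "\<bar>(\<Sum>k<n. f (?x k)) - real n * integral {0..1} f\<bar> = real n * \<bar>\<Sum>k<n. ?e k\<bar>"
      by (simp only: abs_minus_cancel abs_mult abs_of_nat)
    also have "\<dots> \<le> real n * (\<Sum>k<n. K / real n ^ 3)"
      using e by (intro mult_left_mono order_trans[OF sum_abs] sum_mono) auto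
    also have "\<dots> = K / real n" using n by (simp add: power3_eq_cube)
    finally show ?thesis .
  qed
  show ?thesis
  proof (rule Lim_null_comparison)
    show "(\<lambda>n. K / real n) \<longlonglongrightarrow> 0"
      by (intro tendsto_divide_0[OF tendsto_const] filterlim_real_sequentially[THEN filterlim_at_top_imp_at_infinity])
    show "\<forall>\<^sub>F n in sequentially. norm ((\<Sum>k<n. f (real k / real n)) - real n * integral {0..1} f) \<le> K / real n"
      using bound by (intro eventually_sequentiallyI[of 1]) auto
  qed
qed

section \<open>The integral of the logarithm of the sine\<close>

text \<open>
  The primitive \<open>x ln x - x\<close> extends continuously to \<open>0\<close>.
\<close>
lemma integrable_ln_half: "ln integrable_on {0..1/2::real}"
proof -
  define F where "F x = x * ln x - x" for x :: real
  have "(ln has_integral F (1/2) - F 0) {0..1/2}"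
  proof (rule fundamental_theorem_of_calculus_interior)
    show "continuous_on {0..1/2} F"
      unfolding continuous_on_def
    proof
      fix x :: real assume x: "x \<in> {0..1/2}"
      show "(F \<longlongrightarrow> F x) (at x within {0..1/2})"
      proof (cases "x = 0")
        case True
        have "((\<lambda>x::real. x * ln x - x) \<longlongrightarrow> 0) (at_right 0)" by real_asymp
        then have "(F \<longlongrightarrow> F 0) (at_right 0)" by (simp add: F_def[abs_def])
        moreover have "at (0::real) within {0..1/2} = at_right 0"
          by (rule at_within_Icc_at_right) simp
        ultimately show ?thesis using True by simp
      next
        case False
        then show ?thesis unfolding F_def using x by (intro tendsto_intros) auto
      qed
    qed
    fix x :: real assume x: "x \<in> {0<..<1/2}"
    have "(F has_real_derivative ln x) (at x)"
      unfolding F_def using x by (auto intro!: derivative_eq_intros)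
    then show "(F has_vector_derivative ln x) (at x)"
      by (simp add: has_real_derivative_iff_has_vector_derivative)
  qed simp
  then show ?thesis by blast
qed

text \<open>
  On the left half, \<open>sin (\<pi> \<theta>) / \<theta>\<close> is continuous and positive, so the singularity is that of
  \<open>2 ln \<theta>\<close>. The right half follows by the symmetry \<open>\<theta> \<mapsto> 1 - \<theta>\<close>.
\<close>
lemma integrable_ln_sin: "(\<lambda>\<theta>. ln (4 * (sin (pi * \<theta>))\<^sup>2)) integrable_on {0..1}"
proof -
  let ?g = "\<lambda>\<theta>. ln (4 * (sin (pi * \<theta>))\<^sup>2)"
  \<comment> \<open>The value at \<open>0\<close> is the derivative of \<open>sin (\<pi> \<theta>)\<close> there, which makes \<open>r\<close> continuous.\<close>
  define r where "r \<theta> = (if \<theta> = 0 then pi else sin (pi * \<theta>) / \<theta>)" for \<theta> :: real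
  have r_pos: "r \<theta> > 0" if "\<theta> \<in> {0..1/2}" for \<theta>
  proof (cases "\<theta> = 0")
    case False
    then have "0 < \<theta>" "pi * \<theta> < pi * 1" using that by (auto intro!: mult_strict_left_mono)
    then show ?thesis by (auto simp: r_def intro!: divide_pos_pos sin_gt_zero)
  qed (simp add: r_def)
  have "isCont r \<theta>" for \<theta>
  proof (cases "\<theta> = 0")
    case True
    have "((\<lambda>x. sin (pi * x)) has_real_derivative pi) (at 0)"
      by (auto intro!: derivative_eq_intros)
    then have "(\<lambda>h. sin (pi * h) / h) \<midarrow>0\<rightarrow> pi" by (simp add: DERIV_def)
    then have "r \<midarrow>0\<rightarrow> pi"
      by (rule Lim_transform_eventually) (simp add: r_def eventually_at_filter)
    then show ?thesis using True by (simp add: isCont_def r_def)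
  next
    case False
    have "isCont (\<lambda>x. sin (pi * x) / x) \<theta>" using False by (intro continuous_intros) auto
    moreover have "\<forall>\<^sub>F x in nhds \<theta>. r x = sin (pi * x) / x"
      using t1_space_nhds[OF False] by eventually_elim (simp add: r_def)
    then have "isCont r \<theta> \<longleftrightarrow> isCont (\<lambda>x. sin (pi * x) / x) \<theta>" by (rule isCont_cong)
    ultimately show ?thesis by simp
  qed
  then have r_cont: "continuous_on {0..1/2} r" by (simp add: continuous_at_imp_continuous_on)
  have "(\<lambda>\<theta>. ln (4 * (r \<theta>)\<^sup>2)) integrable_on {0..1/2}"
  proof (intro integrable_continuous_interval continuous_intros r_cont ballI)
    show "4 * (r \<theta>)\<^sup>2 \<noteq> 0" if "\<theta> \<in> {0..1/2}" for \<theta> using r_pos[OF that] by simp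
  qed
  then have int: "(\<lambda>\<theta>. 2 * ln \<theta> + ln (4 * (r \<theta>)\<^sup>2)) integrable_on {0..1/2}"
    using integrable_on_mult_right[OF integrable_ln_half, of 2] by (intro integrable_add)
  have eq: "?g \<theta> = 2 * ln \<theta> + ln (4 * (r \<theta>)\<^sup>2)" if "\<theta> \<in> {0..1/2} - {0}" for \<theta>
  proof -
    have \<theta>: "0 < \<theta>" "\<theta> \<le> 1/2" using that by auto
    then have "pi * \<theta> < pi * 1" by (intro mult_strict_left_mono) auto
    then have "sin (pi * \<theta>) > 0" using \<theta> by (intro sin_gt_zero) auto
    then have r: "4 * (sin (pi * \<theta>))\<^sup>2 = \<theta>\<^sup>2 * (4 * (r \<theta>)\<^sup>2)" "r \<theta> > 0"
      using \<theta> by (auto simp: r_def power_divide)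
    have "ln (\<theta>\<^sup>2 * (4 * (r \<theta>)\<^sup>2)) = ln (\<theta>\<^sup>2) + ln (4 * (r \<theta>)\<^sup>2)"
      using \<theta> r(2) by (intro ln_mult_pos) auto
    then show ?thesis using \<theta> by (simp only: r(1)) (simp add: ln_realpow)
  qed
  have left: "?g integrable_on {0..1/2}"
  proof (rule integrable_spike[OF int])
    show "negligible {0::real}" by simp
  qed (rule eq)
  obtain I where I: "(?g has_integral I) (cbox 0 (1/2))" using left unfolding cbox_interval by blast
  have "((\<lambda>x. ?g (-1 *\<^sub>R x + 1)) has_integral (1 / \<bar>-1\<bar> ^ DIM(real)) *\<^sub>R I)
      ((\<lambda>x. (1 / -1) *\<^sub>R x + - ((1 / -1) *\<^sub>R 1)) ` cbox 0 (1/2))"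
    by (rule has_integral_affinity[OF I]) simp
  moreover have "(\<lambda>x::real. (1 / -1) *\<^sub>R x + - ((1 / -1) *\<^sub>R 1)) ` cbox 0 (1/2) = {1/2..1}"
    using image_affinity_atLeastAtMost[of "-1::real" 1 0 "1/2"] by simp
  moreover have "?g (-1 *\<^sub>R x + 1) = ?g x" for x
    by (simp add: algebra_simps sin_diff)
  ultimately have right: "?g integrable_on {1/2..1}" by auto
  show ?thesis by (rule Henstock_Kurzweil_Integration.integrable_combine[OF _ _ left right]) simp_all
qed

text \<open>
  Euler's duplication argument: with \<open>g \<theta> = ln (4 sin\<^sup>2 (\<pi> \<theta>))\<close> the double-angle formula reads
  \<open>g (2 \<theta>) = g \<theta> + g (\<theta> + 1/2)\<close>. Integration over \<open>[0, 1/2]\<close> gives \<open>I / 2 = I\<close>.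
\<close>
theorem integral_ln_sin: "integral {0..1} (\<lambda>\<theta>. ln (4 * (sin (pi * \<theta>))\<^sup>2)) = 0"
proof -
  let ?g = "\<lambda>\<theta>. ln (4 * (sin (pi * \<theta>))\<^sup>2)"
  define I where "I = integral {0..1} ?g"
  have gI: "(?g has_integral I) (cbox 0 1)"
    using integrable_integral[OF integrable_ln_sin] by (simp add: I_def)
  have half: "?g integrable_on {0..1/2}" "?g integrable_on {1/2..1}"
    using integrable_ln_sin by (auto intro: integrable_subinterval_real)
  have "((\<lambda>x. ?g (2 *\<^sub>R x + 0)) has_integral (1 / \<bar>2\<bar> ^ DIM(real)) *\<^sub>R I)
      ((\<lambda>x. (1 / 2) *\<^sub>R x + - ((1 / 2) *\<^sub>R 0)) ` cbox 0 1)"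
    by (rule has_integral_affinity[OF gI]) simp
  moreover have "(\<lambda>x::real. (1 / 2) *\<^sub>R x + - ((1 / 2) *\<^sub>R 0)) ` cbox 0 1 = {0..1/2}"
    using image_affinity_atLeastAtMost[of "1/2::real" 0 0 1] by simp
  ultimately have dbl: "((\<lambda>x. ?g (2 * x)) has_integral I / 2) {0..1/2}" by simp
  have "((\<lambda>x. ?g (1 *\<^sub>R x + 1/2)) has_integral (1 / \<bar>1\<bar> ^ DIM(real)) *\<^sub>R integral {1/2..1} ?g)
      ((\<lambda>x. (1 / 1) *\<^sub>R x + - ((1 / 1) *\<^sub>R (1/2))) ` cbox (1/2) 1)"
    by (rule has_integral_affinity) (use integrable_integral[OF half(2)] in simp_all)
  moreover have "(\<lambda>x::real. (1 / 1) *\<^sub>R x + - ((1 / 1) *\<^sub>R (1/2))) ` cbox (1/2) 1 = {0..1/2}"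
    using image_affinity_atLeastAtMost[of "1::real" "-1/2" "1/2" 1] by simp
  ultimately have shift: "((\<lambda>x. ?g (x + 1/2)) has_integral integral {1/2..1} ?g) {0..1/2}" by simp
  have "((\<lambda>x. ?g x + ?g (x + 1/2)) has_integral integral {0..1/2} ?g + integral {1/2..1} ?g) {0..1/2}"
    by (rule has_integral_add[OF integrable_integral[OF half(1)] shift])
  also have "integral {0..1/2} ?g + integral {1/2..1} ?g = I"
    unfolding I_def by (rule Henstock_Kurzweil_Integration.integral_combine) (use integrable_ln_sin in auto)
  finally have sum: "((\<lambda>x. ?g x + ?g (x + 1/2)) has_integral I) {0..1/2}" .
  have eq: "?g (2 * x) = ?g x + ?g (x + 1/2)" if "x \<in> {0..1/2} - {0, 1/2}" for x
  proof -
    have x: "0 < x" "x < 1/2" using that by auto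
    then have px: "0 < pi * x" "pi * x < pi / 2" by auto
    have s: "sin (pi * x) > 0" using px by (intro sin_gt_zero) auto
    have c: "cos (pi * x) > 0" using px by (intro cos_gt_zero) auto
    have "sin (pi * (2 * x)) = 2 * sin (pi * x) * cos (pi * x)"
      using sin_double[of "pi * x"] by (simp add: algebra_simps)
    then have d: "4 * (sin (pi * (2 * x)))\<^sup>2 = (4 * (sin (pi * x))\<^sup>2) * (4 * (cos (pi * x))\<^sup>2)"
      by (simp only:) (simp add: power_mult_distrib)
    have sh: "sin (pi * (x + 1/2)) = cos (pi * x)"
      by (simp add: distrib_left sin_add)
    have "ln ((4 * (sin (pi * x))\<^sup>2) * (4 * (cos (pi * x))\<^sup>2)) = ln (4 * (sin (pi * x))\<^sup>2) + ln (4 * (cos (pi * x))\<^sup>2)"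
      using s c by (intro ln_mult_pos) auto
    then show ?thesis by (simp only: d sh)
  qed
  have "((\<lambda>x. ?g (2 * x)) has_integral I) {0..1/2}"
  proof (rule has_integral_spike)
    show "negligible {0, 1/2::real}" by simp
    show "((\<lambda>x. ?g x + ?g (x + 1/2)) has_integral I) {0..1/2}" by (rule sum)
  qed (rule eq)
  then have "I = I / 2" using dbl by (rule has_integral_unique)
  then show ?thesis by (simp add: I_def)
qed

section \<open>Asymptotics of the number of spanning trees\<close>

definition circle_pt :: "real \<Rightarrow> complex" where
  "circle_pt \<theta> = exp (2 * of_real pi * \<i> * of_real \<theta>)"

lemma circle_pt_cis: "circle_pt \<theta> = cis (2 * pi * \<theta>)"
  by (simp add: circle_pt_def cis_conv_exp mult_ac)

lemma norm_one_minus_circle_pt: "(norm (1 - circle_pt \<theta>))\<^sup>2 = 4 * (sin (pi * \<theta>))\<^sup>2"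
proof -
  have "(norm (1 - circle_pt \<theta>))\<^sup>2 = 2 - 2 * cos (2 * (pi * \<theta>))"
    using norm_diff_unit_sq[of 1 "circle_pt \<theta>"] by (simp add: circle_pt_cis mult.assoc)
  then show ?thesis by (simp add: cos_double_sin)
qed

lemma dirichlet_sq_circle_pt:
  "dirichlet_sq m (circle_pt \<theta>) =
    (\<Sum>l<m. cos (2 * pi * real l * \<theta>)) * (\<Sum>l<m. cos (2 * pi * real l * \<theta>)) +
    (\<Sum>l<m. sin (2 * pi * real l * \<theta>)) * (\<Sum>l<m. sin (2 * pi * real l * \<theta>))"
proof -
  have "circle_pt \<theta> ^ l = cis (2 * pi * real l * \<theta>)" for l
    by (simp add: circle_pt_cis Complex.DeMoivre mult_ac)
  then show ?thesis
    unfolding dirichlet_sq_def cmod_power2 by (simp add: power2_eq_square)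
qed

text \<open>
  Along the circle, \<open>Q\<close> is a polynomial in sines and cosines of multiples of \<open>\<theta>\<close>.
\<close>
lemma twice_cont_diff_circle_Q: "twice_cont_diff (\<lambda>\<theta>. circle_Q s t \<beta> \<gamma> (circle_pt \<theta>))"
proof -
  have "twice_cont_diff (\<lambda>\<theta>. dirichlet_sq m (circle_pt \<theta>))" for m
    unfolding dirichlet_sq_circle_pt
    by (intro twice_cont_diff_add twice_cont_diff_mult twice_cont_diff_sum twice_cont_diff_sin twice_cont_diff_cos)
  then show ?thesis
    unfolding circle_Q_def norm_one_minus_circle_pt
    unfolding power2_eq_square
    by (intro twice_cont_diff_add twice_cont_diff_mult twice_cont_diff_sum twice_cont_diff_sin twice_cont_diff_const)
qed

lemma circle_pt_root_of_unity:
  assumes "n > 0"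
  shows "circle_pt (1 / real n) ^ c = circle_pt (real c / real n)"
    and "circle_pt (1 / real n) ^ c = 1 \<longleftrightarrow> n dvd c"
proof -
  show pow: "circle_pt (1 / real n) ^ c = circle_pt (real c / real n)"
    by (simp add: circle_pt_cis Complex.DeMoivre mult_ac)
  have "circle_pt (real c / real n) = exp (2 * of_real pi * \<i> * of_nat c / of_nat n)"
    by (simp add: circle_pt_def)
  then show "circle_pt (1 / real n) ^ c = 1 \<longleftrightarrow> n dvd c"
    unfolding pow using complex_root_unity_eq_1[of n c] assms by simp
qed

text \<open>
  The factor \<open>\<bar>1 - z\<bar>\<^sup>2\<close> has Mahler measure \<open>1\<close>, so only \<open>Q\<close> contributes.
\<close>
lemma mahler_P_eq_integral_circle_Q:
  assumes \<gamma>: "strict_mono_on {1..t} \<gamma>" and pos: "\<And>z. norm z = 1 \<Longrightarrow> circle_Q s t \<beta> \<gamma> z > 0"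
  shows "mahler_P s t \<beta> \<gamma> = exp (integral {0..1} (\<lambda>\<theta>. ln (circle_Q s t \<beta> \<gamma> (circle_pt \<theta>))))"
proof -
  let ?f = "\<lambda>\<theta>. ln (circle_Q s t \<beta> \<gamma> (circle_pt \<theta>))"
  let ?g = "\<lambda>\<theta>. ln (4 * (sin (pi * \<theta>))\<^sup>2)"
  have unit: "norm (circle_pt \<theta>) = 1" for \<theta> by (simp add: circle_pt_cis)
  have "twice_cont_diff ?f"
    by (intro twice_cont_diff_ln twice_cont_diff_circle_Q pos unit)
  then have "continuous_on UNIV ?f" by (rule twice_cont_diffE)
  then have f: "?f integrable_on {0..1}"
    by (intro integrable_continuous_interval) (rule continuous_on_subset, auto)
  have "integral {0..1} (\<lambda>\<theta>. ln (Re (laurent_P s t \<beta> \<gamma> (circle_pt \<theta>)))) = integral {0..1} (\<lambda>\<theta>. ?g \<theta> + ?f \<theta>)"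
  proof (rule integral_spike)
    show "negligible {0, 1::real}" by simp
    fix \<theta> :: real assume "\<theta> \<in> {0..1} - {0, 1}"
    then have "0 < pi * \<theta>" "pi * \<theta> < pi * 1" by (auto intro!: mult_strict_left_mono)
    then have "sin (pi * \<theta>) > 0" by (intro sin_gt_zero) auto
    then have w: "4 * (sin (pi * \<theta>))\<^sup>2 > 0" by simp
    have "Re (laurent_P s t \<beta> \<gamma> (circle_pt \<theta>)) = 4 * (sin (pi * \<theta>))\<^sup>2 * circle_Q s t \<beta> \<gamma> (circle_pt \<theta>)"
      unfolding laurent_P_factor[OF unit \<gamma>] norm_one_minus_circle_pt by (rule Re_complex_of_real)
    then show "?g \<theta> + ?f \<theta> = ln (Re (laurent_P s t \<beta> \<gamma> (circle_pt \<theta>)))"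
      using ln_mult_pos[OF w pos[OF unit]] by simp
  qed
  also have "\<dots> = integral {0..1} ?g + integral {0..1} ?f"
    by (rule Henstock_Kurzweil_Integration.integral_add[OF integrable_ln_sin f])
  finally show ?thesis by (simp add: mahler_P_def circle_pt_def integral_ln_sin)
qed

text \<open>
  In \<open>dih_tau_product\<close> the factors \<open>\<bar>1 - \<omega>\<^sup>c\<bar>\<^sup>2\<close> contribute \<open>n\<^sup>2\<close>, and multiplication by \<open>q = Q(1)\<close>
  completes the product to all \<open>n\<close>-th roots of unity.
\<close>
lemma dih_tau_eq_prod_circle_Q:
  assumes \<beta>: "\<And>i. i \<in> {1..s} \<Longrightarrow> 0 < \<beta> i \<and> 2 * \<beta> i < n" and \<beta>_mono: "strict_mono_on {1..s} \<beta>"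
    and \<gamma>: "\<And>i. i \<in> {1..t} \<Longrightarrow> \<gamma> i < n" and \<gamma>_mono: "strict_mono_on {1..t} \<gamma>" and n: "n > 0"
  shows "dih_q s t \<beta> \<gamma> * real (dih_tau s t \<beta> \<gamma> n) =
    real n * real t * (\<Prod>c<n. circle_Q s t \<beta> \<gamma> (circle_pt (real c / real n)))"
proof -
  define \<omega> where "\<omega> = circle_pt (1 / real n)"
  let ?Q = "circle_Q s t \<beta> \<gamma>"
  have unit: "norm (\<omega> ^ c) = 1" for c by (simp add: \<omega>_def circle_pt_cis norm_power)
  have \<omega>n: "\<omega> ^ n = 1" using circle_pt_root_of_unity(2)[OF n, of n] by (simp add: \<omega>_def)
  have prim: "\<omega> ^ k \<noteq> 1" if "0 < k" "k < n" for k
    using circle_pt_root_of_unity(2)[OF n, of k] that by (auto simp: \<omega>_def dest: dvd_imp_le)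
  have inj: "inj_on \<beta> {1..s}" "inj_on \<gamma> {1..t}"
    using \<beta>_mono \<gamma>_mono by (auto intro: strict_mono_on_imp_inj_on)
  have "(\<Prod>c=1..<n. (norm (1 - \<omega> ^ c))\<^sup>2) = (norm (\<Prod>c=1..<n. 1 - \<omega> ^ c))\<^sup>2"
    by (simp add: prod_norm[symmetric] prod_power_distrib[symmetric])
  also have "\<dots> = (real n)\<^sup>2"
    by (simp only: prod_roots_of_unity_minus[OF \<omega>n prim n] norm_of_nat)
  finally have w: "(\<Prod>c=1..<n. (norm (1 - \<omega> ^ c))\<^sup>2) = (real n)\<^sup>2" .
  have "(of_nat n * of_nat (dih_tau s t \<beta> \<gamma> n) :: complex) = of_nat t * (\<Prod>c=1..<n. laurent_P s t \<beta> \<gamma> (\<omega> ^ c))"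
    by (rule dih_tau_product[OF \<beta> inj(1) \<gamma> inj(2) n \<omega>n prim])
  also have "\<dots> = of_real (real t * (\<Prod>c=1..<n. (norm (1 - \<omega> ^ c))\<^sup>2 * ?Q (\<omega> ^ c)))"
    by (simp only: laurent_P_factor[OF unit \<gamma>_mono] of_real_mult of_real_prod of_real_of_nat_eq)
  also have "(\<Prod>c=1..<n. (norm (1 - \<omega> ^ c))\<^sup>2 * ?Q (\<omega> ^ c)) = (real n)\<^sup>2 * (\<Prod>c=1..<n. ?Q (\<omega> ^ c))"
    by (simp only: prod.distrib w)
  finally have "of_real (real n * real (dih_tau s t \<beta> \<gamma> n)) =
      (of_real (real t * ((real n)\<^sup>2 * (\<Prod>c=1..<n. ?Q (\<omega> ^ c)))) :: complex)"
    by (simp only: of_real_mult of_real_of_nat_eq)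
  then have "real n * real (dih_tau s t \<beta> \<gamma> n) = real n * (real n * real t * (\<Prod>c=1..<n. ?Q (\<omega> ^ c)))"
    by (simp only: of_real_eq_iff power2_eq_square mult_ac)
  then have \<tau>: "real (dih_tau s t \<beta> \<gamma> n) = real n * real t * (\<Prod>c=1..<n. ?Q (\<omega> ^ c))"
    using n by (simp only: mult_cancel_left) simp
  have "{..<n} = insert 0 {1..<n}" using n by auto
  then have "(\<Prod>c<n. ?Q (\<omega> ^ c)) = ?Q (\<omega> ^ 0) * (\<Prod>c=1..<n. ?Q (\<omega> ^ c))"
    by (simp only:) (rule prod.insert, simp_all)
  then have "(\<Prod>c<n. ?Q (\<omega> ^ c)) = dih_q s t \<beta> \<gamma> * (\<Prod>c=1..<n. ?Q (\<omega> ^ c))"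
    by (simp only: power_0 circle_Q_one[OF \<gamma>_mono])
  moreover have "\<omega> ^ c = circle_pt (real c / real n)" for c
    unfolding \<omega>_def by (rule circle_pt_root_of_unity(1)[OF n])
  ultimately show ?thesis by (simp add: \<tau>)
qed

theorem theorem5p1:
  fixes s t :: nat and \<beta> \<gamma> :: "nat \<Rightarrow> nat"
  assumes "t \<ge> 1"
    and "\<And>i. i \<in> {1..s} \<Longrightarrow> \<beta> i > 0"
    and "strict_mono_on {1..s} \<beta>"
    and "strict_mono_on {1..t} \<gamma>"
    and "\<forall>\<^sub>F n in sequentially. dih_graph_connected s t \<beta> \<gamma> n"
  shows "(\<lambda>n. real (dih_tau s t \<beta> \<gamma> n) /
            (real n * real t / dih_q s t \<beta> \<gamma> * mahler_P s t \<beta> \<gamma> ^ n))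
          \<longlonglongrightarrow> 1"
proof -
  let ?Q = "\<lambda>\<theta>. circle_Q s t \<beta> \<gamma> (circle_pt \<theta>)"
  let ?I = "integral {0..1} (\<lambda>\<theta>. ln (?Q \<theta>))"
  have pos: "circle_Q s t \<beta> \<gamma> z > 0" if "norm z = 1" for z
    using circle_Q_pos[OF assms(1,2,4,5) that] .
  have Qpos: "?Q \<theta> > 0" for \<theta> by (rule pos) (simp add: circle_pt_cis)
  have q: "dih_q s t \<beta> \<gamma> > 0" using pos[of 1] circle_Q_one[OF assms(4)] by simp
  have "(\<lambda>n. (\<Sum>k<n. ln (?Q (real k / real n))) - real n * ?I) \<longlonglongrightarrow> 0"
  proof (rule periodic_riemann_sum)
    show "twice_cont_diff (\<lambda>\<theta>. ln (?Q \<theta>))"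
      by (intro twice_cont_diff_ln twice_cont_diff_circle_Q Qpos)
    show "ln (?Q 0) = ln (?Q 1)" by (simp add: circle_pt_cis)
  qed
  then have lim: "(\<lambda>n. exp ((\<Sum>k<n. ln (?Q (real k / real n))) - real n * ?I)) \<longlonglongrightarrow> exp 0"
    by (rule tendsto_exp)
  \<comment> \<open>A crude bound beyond which the generators are distinct for every \<open>n\<close>.\<close>
  define N where "N = 1 + 2 * (\<Sum>i=1..s. \<beta> i) + (\<Sum>i=1..t. \<gamma> i)"
  have "exp ((\<Sum>k<n. ln (?Q (real k / real n))) - real n * ?I) =
      real (dih_tau s t \<beta> \<gamma> n) / (real n * real t / dih_q s t \<beta> \<gamma> * mahler_P s t \<beta> \<gamma> ^ n)"
    if n: "n \<ge> N" for n
  proof -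
    have n0: "n > 0" using n by (simp add: N_def)
    have \<beta>: "0 < \<beta> i \<and> 2 * \<beta> i < n" if "i \<in> {1..s}" for i
    proof -
      have "\<beta> i \<le> (\<Sum>i=1..s. \<beta> i)" by (rule member_le_sum[OF that]) auto
      then show ?thesis using assms(2)[OF that] n by (simp add: N_def)
    qed
    have \<gamma>: "\<gamma> i < n" if "i \<in> {1..t}" for i
    proof -
      have "\<gamma> i \<le> (\<Sum>i=1..t. \<gamma> i)" by (rule member_le_sum[OF that]) auto
      then show ?thesis using n by (simp add: N_def)
    qed
    have "exp (\<Sum>k<n. ln (?Q (real k / real n))) = (\<Prod>k<n. ?Q (real k / real n))"
      using Qpos by (simp add: exp_sum)
    also have "\<dots> = dih_q s t \<beta> \<gamma> * real (dih_tau s t \<beta> \<gamma> n) / (real n * real t)"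
      using dih_tau_eq_prod_circle_Q[OF \<beta> assms(3) \<gamma> assms(4) n0] n0 assms(1) by (simp add: field_simps)
    finally have "exp ((\<Sum>k<n. ln (?Q (real k / real n))) - real n * ?I) =
        dih_q s t \<beta> \<gamma> * real (dih_tau s t \<beta> \<gamma> n) / (real n * real t) / exp ?I ^ n"
      by (simp only: exp_diff exp_of_nat_mult)
    then show ?thesis
      using mahler_P_eq_integral_circle_Q[OF assms(4) pos] q n0 assms(1) by (simp add: field_simps)
  qed
  then have "\<forall>\<^sub>F n in sequentially. exp ((\<Sum>k<n. ln (?Q (real k / real n))) - real n * ?I) =
      real (dih_tau s t \<beta> \<gamma> n) / (real n * real t / dih_q s t \<beta> \<gamma> * mahler_P s t \<beta> \<gamma> ^ n)"
    by (intro eventually_sequentiallyI[of N])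
  from Lim_transform_eventually[OF lim this] show ?thesis by simp
qed

end
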